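(* For every fixed $\alpha,\varepsilon>0$ and fixed $\Delta\geq 0$ there exists a constant $\beta>0$ such that the following holds. If $G$ is a graph on $n$ vertices of maximum degree $\Delta$ with average degree $\widetilde{d}=\widetilde{d}(G)$ and $\theta=\theta(G)$ satisfying $\widetilde{d}-\theta>\varepsilon$, and $\widehat{G}$ is the random graph obtained from $G$ by deleting every vertex independently with probability $p=n^{-\alpha}$, then w.h.p. $\widehat{G}$ has a connected component of size $n-o(n)$ that is a $\beta$-expander, and all other connected components are of cardinality at most $$\frac{\theta^2}{(\widetilde{d}^2-\theta^2)\alpha}.$$
   Context: Graphs are finite and simple. The combinatorial Laplacian of a graph $G$ on $n$ vertices is $L(G)=D-A(G)$, where $A(G)$ is the adjacency matrix and $D$ is the diagonal matrix of vertex degrees. Its eigenvalues are $0=\sigma_0\le\sigma_1\le\dots\le\sigma_{n-1}$, where $\sigma_0$ corresponds to the all-ones eigenvector. $\widetilde{d}(G)$ is the average degree of $G$, and $\theta(G)=\max\{|\widetilde{d}-\sigma_i|: i>0\}$. For $U\subseteq V(H)$, $N_H(U)=\{v\notin U: v\text{ has a neighbor in }U\}$. A graph $H$ on $m$ vertices is a $\beta$-expander ($\beta>0$) if $|N_H(U)|\ge\beta|U|$ for every set $U$ of at most $m/2$ vertices. A connected component is a $\beta$-expander if its induced subgraph is a $\beta$-expander with respect to its own number of vertices. Deletion process: each vertex of $G$ is deleted independently with probability $n^{-\alpha}$; $\widehat{G}$ is the subgraph of $G$ induced by the non-deleted vertices. Asymptotics are as $n\to\infty$: the statement is about every family $\{G_n\}$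 of graphs ($G_n$ on $n$ vertices) satisfying the hypotheses with $\alpha,\varepsilon,\Delta$ fixed ($\widetilde d$ and $\theta$ may depend on $n$), and an event holds w.h.p. if its probability tends to $1$ as $n\to\infty$. *)

theory Defs
  imports
    "HOL-Probability.Probability"
    "HOL-Library.Landau_Symbols"
    "Jordan_Normal_Form.Char_Poly"
    "Graph_Theory.Graph_Theory"
begin

text \<open>
  A finite simple graph is a symmetric, loop-free, finite digraph without parallel arcs
  (locale \<open>graph\<close>, or \<open>pair_graph\<close> when arcs are pairs); every edge is a pair of opposite arcs.
  Hence the degree of a vertex is its \<open>out_degree\<close>.
\<close>

definition max_degree :: "('a, 'b) pre_digraph \<Rightarrow> nat" where
  "max_degree G = Max (out_degree G ` verts G)"

definition avg_degree :: "('a, 'b) pre_digraph \<Rightarrow> real" where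
  "avg_degree G = (\<Sum>v\<in>verts G. real (out_degree G v)) / real (card (verts G))"

text \<open>
  Row and column \<open>i\<close> of the matrices below belong to the \<open>i\<close>-th smallest vertex.
\<close>

definition vertex_list :: "('a :: linorder, 'b) pre_digraph \<Rightarrow> 'a list" where
  "vertex_list G = sorted_list_of_set (verts G)"

definition adjacency_mat :: "('a :: linorder, 'b) pre_digraph \<Rightarrow> real mat" where
  "adjacency_mat G = Matrix.mat (card (verts G)) (card (verts G))
     (\<lambda>(i, j). if (vertex_list G ! i, vertex_list G ! j) \<in> arcs_ends G then 1 else 0)"

definition degree_mat :: "('a :: linorder, 'b) pre_digraph \<Rightarrow> real mat" where
  "degree_mat G = Matrix.mat (card (verts G)) (card (verts G))
     (\<lambda>(i, j). if i = j then real (out_degree G (vertex_list G ! i)) else 0)"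

definition laplacian :: "('a :: linorder, 'b) pre_digraph \<Rightarrow> real mat" where
  "laplacian G = degree_mat G - adjacency_mat G"

text \<open>
  The eigenvalues with multiplicity, in increasing order. The Laplacian is positive
  semidefinite, so entry \<open>0\<close> is the eigenvalue \<open>0\<close> of the all-ones vector.
\<close>

definition laplacian_spectrum :: "('a :: linorder, 'b) pre_digraph \<Rightarrow> real list" where
  "laplacian_spectrum G = sorted_list_of_multiset (proots (char_poly (laplacian G)))"

text \<open>Meaningful only for graphs with at least two vertices.\<close>

definition theta :: "('a :: linorder, 'b) pre_digraph \<Rightarrow> real" where
  "theta G = Max {\<bar>avg_degree G - laplacian_spectrum G ! i\<bar> | i. 0 < i \<and> i < card (verts G)}"

definition neighborhood :: "('a, 'b) pre_digraph \<Rightarrow> 'a set \<Rightarrow> 'a set" where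
  "neighborhood H U = {v \<in> verts H - U. \<exists>u\<in>U. v \<rightarrow>\<^bsub>H\<^esub> u}"

definition expander :: "real \<Rightarrow> ('a, 'b) pre_digraph \<Rightarrow> bool" where
  "expander \<beta> H \<longleftrightarrow> (\<forall>U \<subseteq> verts H. real (card U) \<le> real (card (verts H)) / 2 \<longrightarrow>
     real (card (neighborhood H U)) \<ge> \<beta> * real (card U))"

definition components :: "('a, 'b) pre_digraph \<Rightarrow> ('a, 'b) pre_digraph set" where
  "components H = {C. pre_digraph.max_subgraph H Digraph_Component.connected C}"

definition random_deletion :: "('a, 'b) pre_digraph \<Rightarrow> real \<Rightarrow> ('a, 'b) pre_digraph pmf" where
  "random_deletion G p =
     map_pmf (\<lambda>deleted. G \<restriction> {v \<in> verts G. \<not> deleted v})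
       (Pi_pmf (verts G) False (\<lambda>_. bernoulli_pmf p))"

end

theory Submission
  imports Defs "HOL-Real_Asymp.Real_Asymp"
begin

unbundle no vec_syntax

text \<open>
  Let \<open>d\<close> be the average degree, \<open>L\<close> the Laplacian, \<open>\<theta>\<close> the spectral parameter, and let
  \<open>U\<close> be a set of \<open>u\<close> vertices with \<open>w\<close> outside neighbours.

  \<^bold>\<open>Spectral part.\<close> On functions of sum zero the symmetric operator \<open>M = d - L\<close> is bounded by
  \<open>\<theta>\<close>. The function \<open>M 1\<^sub>U\<close> has sum \<open>d u\<close> and lives on \<open>U\<close> and its neighbourhood, so
  the Cauchy-Schwarz inequality gives \<open>(d u)\<^sup>2 \<le> (u + w) \<parallel>M 1\<^sub>U\<parallel>\<^sup>2\<close>, where \<open>\<parallel>M 1\<^sub>U\<parallel>\<^sup>2\<close> is at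
  most \<open>\<theta>\<^sup>2 u\<close> up to a term of order \<open>u\<^sup>2 / n\<close>. Hence every set of at most half of the vertices
  has at least \<open>c u\<close> neighbours (\<open>card_neighborhood_ge\<close>), and a set of bounded size has
  \<open>w \<ge> u (d\<^sup>2 - \<theta>\<^sup>2) / \<theta>\<^sup>2 - O(1 / n)\<close>.

  A set of bounded size that exceeds the bound of the theorem thus has roughly more than
  \<open>1 / \<alpha>\<close> neighbours, and all of them are deleted with probability roughly below \<open>1 / n\<close>. When
  \<open>1 / \<alpha>\<close> is an integer, this alone leaves room for exactly \<open>1 / \<alpha>\<close> neighbours and a
  probability of order \<open>1 / n\<close> for each of linearly many sets. A strict gain is needed. If the
  estimate were nearly tight, \<open>1\<^sub>U\<close> would nearly be an eigenfunction of \<open>M\<^sup>2\<close>; but \<open>M\<^sup>2 1\<^sub>U\<close> is at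
  least \<open>1\<close> at every vertex at distance two from \<open>U\<close>, where \<open>1\<^sub>U\<close> vanishes. This yields
  \<open>w \<ge> u (d\<^sup>2 - \<theta>\<^sup>2) / \<theta>\<^sup>2 + \<delta>\<close> with a constant \<open>\<delta> > 0\<close>
  (\<open>card_neighborhood_ge_strict\<close>).

  \<^bold>\<open>Probabilistic part.\<close> A connected set of size \<open>u\<close> is traced by a walk with \<open>2 u - 2\<close>
  steps, so there are at most \<open>n B\<^bsup>2u\<^esup>\<close> of them in a graph of maximum degree at most \<open>B\<close>. By
  union bounds, with high probability no connected set with more than \<open>K\<close> vertices loses half of
  its \<open>c u\<close> guaranteed neighbours, and no connected set with at most \<open>K\<close> vertices and at least
  \<open>1 / \<alpha> + \<delta>\<close> neighbours loses all of them; by Markov's inequality fewer than \<open>n\<^bsup>1 - \<alpha>/2\<^esup>\<close>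
  vertices are deleted.

  \<^bold>\<open>Deterministic part.\<close> These three properties of the deleted set \<open>D\<close> suffice
  (\<open>deletion_leaves_expander\<close>). A union of components with at most half of the vertices has all
  its neighbours in \<open>D\<close>, so it has at most \<open>card D / c\<close> vertices; putting components together
  cannot jump over the gap between that bound and \<open>n / 2\<close>, so one component is a giant. Inside
  the giant, the edge boundary is additive over connected pieces without edges between them, which
  reduces expansion to connected sets.
\<close>

section \<open>Extremal eigenfunctions of symmetric kernels\<close>

lemma quadratic_nonneg_imp_linear_coeff_zero:
  fixes b c :: real
  assumes "\<And>t. 0 \<le> 2 * t * b + t\<^sup>2 * c"
  shows "b = 0"
proof (rule ccontr)
  assume "b \<noteq> 0"
  \<comment> \<open>At \<open>t = - b / k\<close> with \<open>k > c\<close> the linear term outweighs the quadratic one.\<close>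
  define k where "k = \<bar>c\<bar> + 1"
  have k: "k > 0" "c < k" by (auto simp: k_def)
  have "2 * (- b / k) * b + (- b / k)\<^sup>2 * c = (b\<^sup>2 / k) * (c / k - 2)"
    using k by (simp add: field_simps power2_eq_square)
  moreover have "b\<^sup>2 / k > 0" using k \<open>b \<noteq> 0\<close> by simp
  moreover have "c / k - 2 < 0"
  proof -
    have "c / k < 1" using k by simp
    then show ?thesis by simp
  qed
  ultimately have "2 * (- b / k) * b + (- b / k)\<^sup>2 * c < 0"
    by (metis mult_pos_neg)
  then show False using assms[of "- b / k"] by linarith
qed

definition zero_sum_functions :: "'a set \<Rightarrow> ('a \<Rightarrow> real) set" where
  "zero_sum_functions V = {f. (\<forall>v. v \<notin> V \<longrightarrow> f v = 0) \<and> sum f V = 0}"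

text \<open>
  The unit sphere sits inside a product of compact intervals, which is compact by Tychonoff's
  theorem; this avoids choosing a Euclidean space whose dimension depends on \<open>V\<close>.
\<close>
lemma compact_unit_zero_sum_functions:
  assumes fin: "finite V"
  shows "compact {f \<in> zero_sum_functions V. (\<Sum>v\<in>V. (f v)\<^sup>2) = 1}" (is "compact ?S")
proof -
  let ?P = "PiE UNIV (\<lambda>v. if v \<in> V then {- 1..1} else {0 :: real})"
  have co: "continuous_on UNIV (\<lambda>f :: 'a \<Rightarrow> real. f v)" for v
    by (rule continuous_on_product_coordinates)
  have "compactin (product_topology (\<lambda>_. euclidean) UNIV) ?P"
    unfolding compactin_PiE by auto
  then have P: "compact ?P"
    by (simp add: euclidean_product_topology)
  have "closed {f :: 'a \<Rightarrow> real. sum f V = 0}"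
    by (intro closed_Collect_eq continuous_intros co)
  moreover have "closed {f :: 'a \<Rightarrow> real. (\<Sum>v\<in>V. (f v)\<^sup>2) = 1}"
    by (intro closed_Collect_eq continuous_intros co)
  ultimately have "compact (?P \<inter> ({f. sum f V = 0} \<inter> {f. (\<Sum>v\<in>V. (f v)\<^sup>2) = 1}))"
    using P by (intro compact_Int_closed closed_Int)
  also have "?P \<inter> ({f. sum f V = 0} \<inter> {f. (\<Sum>v\<in>V. (f v)\<^sup>2) = 1}) = ?S"
  proof (intro equalityI subsetI)
    fix f assume "f \<in> ?P \<inter> ({f. sum f V = 0} \<inter> {f. (\<Sum>v\<in>V. (f v)\<^sup>2) = 1})"
    then show "f \<in> ?S" by (auto simp: zero_sum_functions_def PiE_iff split: if_splits)
  next
    fix f assume f: "f \<in> ?S"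
    have "f v \<in> {- 1..1}" if "v \<in> V" for v
    proof -
      have "(f v)\<^sup>2 \<le> (\<Sum>v\<in>V. (f v)\<^sup>2)"
        using fin that by (intro member_le_sum) auto
      then have "(f v)\<^sup>2 \<le> 1" using f by simp
      then have "\<bar>f v\<bar> \<le> 1" by (simp add: abs_square_le_1)
      then show ?thesis by auto
    qed
    then show "f \<in> ?P \<inter> ({f. sum f V = 0} \<inter> {f. (\<Sum>v\<in>V. (f v)\<^sup>2) = 1})"
      using f by (auto simp: zero_sum_functions_def PiE_iff)
  qed
  finally show ?thesis .
qed

definition kernel_operator :: "'a set \<Rightarrow> ('a \<Rightarrow> 'a \<Rightarrow> real) \<Rightarrow> ('a \<Rightarrow> real) \<Rightarrow> 'a \<Rightarrow> real" where
  "kernel_operator V K f v = (if v \<in> V then \<Sum>w\<in>V. K v w * f w else 0)"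

lemma kernel_operator_add_scaled:
  "kernel_operator V K (\<lambda>v. f v + c * g v) = (\<lambda>v. kernel_operator V K f v + c * kernel_operator V K g v)"
  by (auto simp: kernel_operator_def fun_eq_iff sum.distrib sum_distrib_left algebra_simps)

lemma kernel_operator_symmetric:
  assumes "\<And>v w. v \<in> V \<Longrightarrow> w \<in> V \<Longrightarrow> K v w = K w v"
  shows "(\<Sum>v\<in>V. kernel_operator V K f v * g v) = (\<Sum>v\<in>V. f v * kernel_operator V K g v)"
proof -
  have "(\<Sum>v\<in>V. kernel_operator V K f v * g v) = (\<Sum>v\<in>V. \<Sum>w\<in>V. K v w * f w * g v)"
    by (simp add: kernel_operator_def sum_distrib_right)
  also have "\<dots> = (\<Sum>w\<in>V. \<Sum>v\<in>V. K v w * f w * g v)" by (rule sum.swap)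
  also have "\<dots> = (\<Sum>w\<in>V. \<Sum>v\<in>V. f w * (K w v * g v))"
    using assms by (intro sum.cong refl) simp
  also have "\<dots> = (\<Sum>w\<in>V. f w * kernel_operator V K g w)"
    by (simp add: kernel_operator_def sum_distrib_left)
  finally show ?thesis .
qed

lemma sum_kernel_operator:
  assumes sym: "\<And>v w. v \<in> V \<Longrightarrow> w \<in> V \<Longrightarrow> K v w = K w v"
    and row: "\<And>v. v \<in> V \<Longrightarrow> (\<Sum>w\<in>V. K v w) = k"
  shows "sum (kernel_operator V K f) V = k * sum f V"
proof -
  have "sum (kernel_operator V K f) V = (\<Sum>v\<in>V. f v * kernel_operator V K (\<lambda>_. 1) v)"
    using kernel_operator_symmetric[of V K f "\<lambda>_. 1", OF sym] by simp
  also have "\<dots> = (\<Sum>v\<in>V. f v * k)"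
    by (intro sum.cong refl) (simp add: kernel_operator_def row)
  finally show ?thesis by (simp add: sum_distrib_left mult.commute)
qed

lemma zero_sum_functions_kernel_operator:
  assumes "\<And>v w. v \<in> V \<Longrightarrow> w \<in> V \<Longrightarrow> K v w = K w v"
    and "\<And>v. v \<in> V \<Longrightarrow> (\<Sum>w\<in>V. K v w) = k"
    and "f \<in> zero_sum_functions V"
  shows "kernel_operator V K f \<in> zero_sum_functions V"
  using sum_kernel_operator[of V K k f, OF assms(1,2)] assms(3)
  by (simp add: zero_sum_functions_def kernel_operator_def)

lemma zero_sum_functions_add_scaled:
  "f \<in> zero_sum_functions V \<Longrightarrow> g \<in> zero_sum_functions V \<Longrightarrow>
    (\<lambda>v. f v + c * g v) \<in> zero_sum_functions V"
  by (auto simp: zero_sum_functions_def sum.distrib sum_distrib_left[symmetric])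

lemma zero_sum_eq_zeroI:
  assumes "finite V" "f \<in> zero_sum_functions V" "(\<Sum>v\<in>V. (f v)\<^sup>2) = 0"
  shows "f = (\<lambda>_. 0)"
proof
  fix v
  have "\<forall>v\<in>V. (f v)\<^sup>2 = 0" using assms by (subst (asm) sum_nonneg_eq_0_iff) auto
  then show "f v = 0" using assms(2) by (cases "v \<in> V") (auto simp: zero_sum_functions_def)
qed

text \<open>
  Maximise \<open>\<parallel>T f\<parallel>\<^sup>2\<close> over the unit sphere of sum-zero functions. At a maximiser the first variation
  vanishes, so \<open>T\<^sup>2 f = m f\<close> with the maximal value \<open>m\<close>. Factoring
  \<open>T\<^sup>2 - m = (T - \<surd>m) (T + \<surd>m)\<close> then produces an eigenfunction of \<open>T\<close> itself, with eigenvalue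
  \<open>\<surd>m\<close> or \<open>- \<surd>m\<close>.
\<close>
theorem extremal_eigenfunction:
  fixes K :: "'a \<Rightarrow> 'a \<Rightarrow> real"
  assumes fin: "finite V" and card: "2 \<le> card V"
    and sym: "\<And>v w. v \<in> V \<Longrightarrow> w \<in> V \<Longrightarrow> K v w = K w v"
    and row: "\<And>v. v \<in> V \<Longrightarrow> (\<Sum>w\<in>V. K v w) = k"
  obtains f \<mu> where "f \<in> zero_sum_functions V" "f \<noteq> (\<lambda>_. 0)"
    "kernel_operator V K f = (\<lambda>v. \<mu> * f v)"
    "\<And>g. g \<in> zero_sum_functions V \<Longrightarrow>
      (\<Sum>v\<in>V. (kernel_operator V K g v)\<^sup>2) \<le> \<mu>\<^sup>2 * (\<Sum>v\<in>V. (g v)\<^sup>2)"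
proof -
  let ?T = "kernel_operator V K" and ?W = "zero_sum_functions V"
  let ?S = "{f \<in> ?W. (\<Sum>v\<in>V. (f v)\<^sup>2) = 1}"
  note symT = kernel_operator_symmetric[of V K, OF sym]
  have TW: "?T f \<in> ?W" if "f \<in> ?W" for f
    using zero_sum_functions_kernel_operator[of V K k f] sym row that by blast
  obtain a b where ab: "a \<in> V" "b \<in> V" "a \<noteq> b"
  proof -
    obtain A where "A \<subseteq> V" "card A = 2" using card obtain_subset_with_card_n by metis
    then show ?thesis using that by (auto simp: card_2_iff)
  qed
  \<comment> \<open>A unit vector of sum zero, so that the sphere is not empty.\<close>
  define f\<^sub>1 where "f\<^sub>1 v = (if v = a then 1 / sqrt 2 else if v = b then - 1 / sqrt 2 else 0)" for v
  have split: "sum h V = h a + (h b + sum h (V - {a} - {b}))" for h :: "'a \<Rightarrow> real"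
    using fin ab by (simp add: sum.remove[of V a] sum.remove[of "V - {a}" b])
  have "f\<^sub>1 \<in> ?S"
    using ab by (auto simp: zero_sum_functions_def split f\<^sub>1_def power_divide)
  then have ne: "?S \<noteq> {}" by blast
  have "continuous_on ?S (\<lambda>f. \<Sum>v\<in>V. (?T f v)\<^sup>2)"
    unfolding kernel_operator_def
    by (intro continuous_on_sum continuous_on_power)
      (auto intro!: continuous_intros continuous_on_subset[OF continuous_on_product_coordinates])
  then obtain f\<^sub>0 where f\<^sub>0: "f\<^sub>0 \<in> ?S"
    and max: "\<And>g. g \<in> ?S \<Longrightarrow> (\<Sum>v\<in>V. (?T g v)\<^sup>2) \<le> (\<Sum>v\<in>V. (?T f\<^sub>0 v)\<^sup>2)"
    using continuous_attains_sup[OF compact_unit_zero_sum_functions[OF fin] ne] by blast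
  define m where "m = (\<Sum>v\<in>V. (?T f\<^sub>0 v)\<^sup>2)"
  have m: "m \<ge> 0" unfolding m_def by (intro sum_nonneg) auto
  have f\<^sub>0W: "f\<^sub>0 \<in> ?W" and norm: "(\<Sum>v\<in>V. (f\<^sub>0 v)\<^sup>2) = 1" using f\<^sub>0 by auto
  have bound: "(\<Sum>v\<in>V. (?T g v)\<^sup>2) \<le> m * (\<Sum>v\<in>V. (g v)\<^sup>2)" if g: "g \<in> ?W" for g
  proof (cases "(\<Sum>v\<in>V. (g v)\<^sup>2) = 0")
    case True
    then have "g = (\<lambda>_. 0)" using zero_sum_eq_zeroI[OF fin g] by blast
    then show ?thesis by (simp add: kernel_operator_def)
  next
    case False
    define s where "s = (\<Sum>v\<in>V. (g v)\<^sup>2)"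
    have s: "s > 0" using False sum_nonneg[of V "\<lambda>v. (g v)\<^sup>2"] unfolding s_def by fastforce
    have z: "(\<lambda>v. 0) \<in> ?W" by (simp add: zero_sum_functions_def)
    have "(\<lambda>v. 0 + 1 / sqrt s * g v) \<in> ?S"
      using zero_sum_functions_add_scaled[OF z g, of "1 / sqrt s"] s
      by (simp add: power_mult_distrib power_divide sum_divide_distrib[symmetric] s_def[symmetric])
    moreover have T0: "?T (\<lambda>v. 0) v = 0" for v by (simp add: kernel_operator_def)
    ultimately have "(\<Sum>v\<in>V. (?T g v)\<^sup>2) / s \<le> m"
      using s max[of "\<lambda>v. 0 + 1 / sqrt s * g v"] unfolding kernel_operator_add_scaled m_def
      by (simp add: T0 power_mult_distrib power_divide sum_divide_distrib)
    then show ?thesis using s by (simp add: s_def[symmetric] field_simps)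
  qed
  \<comment> \<open>The form \<open>m \<parallel>g\<parallel>\<^sup>2 - \<parallel>T g\<parallel>\<^sup>2\<close> is nonnegative and vanishes at \<open>f\<^sub>0\<close>, so its polar form with \<open>f\<^sub>0\<close> vanishes.\<close>
  have orth: "(\<Sum>v\<in>V. (m * f\<^sub>0 v - ?T (?T f\<^sub>0) v) * y v) = 0" if y: "y \<in> ?W" for y
  proof (rule quadratic_nonneg_imp_linear_coeff_zero)
    fix t
    have "(\<Sum>v\<in>V. (?T f\<^sub>0 v + t * ?T y v)\<^sup>2) \<le> m * (\<Sum>v\<in>V. (f\<^sub>0 v + t * y v)\<^sup>2)"
      using bound[OF zero_sum_functions_add_scaled[OF f\<^sub>0W y, of t]] by (simp add: kernel_operator_add_scaled)
    moreover have "(\<Sum>v\<in>V. (g v + t * h v)\<^sup>2) =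
        (\<Sum>v\<in>V. (g v)\<^sup>2) + 2 * t * (\<Sum>v\<in>V. g v * h v) + t\<^sup>2 * (\<Sum>v\<in>V. (h v)\<^sup>2)" for g h
      by (simp add: power2_sum sum.distrib sum_distrib_left power_mult_distrib algebra_simps)
    ultimately have *: "m + 2 * t * (\<Sum>v\<in>V. ?T f\<^sub>0 v * ?T y v) + t\<^sup>2 * (\<Sum>v\<in>V. (?T y v)\<^sup>2)
        \<le> m * (1 + 2 * t * (\<Sum>v\<in>V. f\<^sub>0 v * y v) + t\<^sup>2 * (\<Sum>v\<in>V. (y v)\<^sup>2))"
      by (simp add: m_def[symmetric] norm)
    have b: "(\<Sum>v\<in>V. (m * f\<^sub>0 v - ?T (?T f\<^sub>0) v) * y v) =
        m * (\<Sum>v\<in>V. f\<^sub>0 v * y v) - (\<Sum>v\<in>V. ?T f\<^sub>0 v * ?T y v)"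
      using symT[of "?T f\<^sub>0" y]
      by (simp add: left_diff_distrib sum_subtractf sum_distrib_left mult.assoc)
    show "0 \<le> 2 * t * (\<Sum>v\<in>V. (m * f\<^sub>0 v - ?T (?T f\<^sub>0) v) * y v)
        + t\<^sup>2 * (m * (\<Sum>v\<in>V. (y v)\<^sup>2) - (\<Sum>v\<in>V. (?T y v)\<^sup>2))"
      unfolding b using * by (simp add: algebra_simps)
  qed
  have TT: "?T (?T f\<^sub>0) v = m * f\<^sub>0 v" for v
  proof -
    let ?y = "\<lambda>v. ?T (?T f\<^sub>0) v + (- m) * f\<^sub>0 v"
    have y: "?y \<in> ?W" using TW f\<^sub>0W by (intro zero_sum_functions_add_scaled) auto
    have "(\<Sum>v\<in>V. (?y v)\<^sup>2) = - (\<Sum>v\<in>V. (m * f\<^sub>0 v - ?T (?T f\<^sub>0) v) * ?y v)"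
      by (simp add: sum_negf[symmetric] power2_eq_square algebra_simps)
    then have "(\<Sum>v\<in>V. (?y v)\<^sup>2) = 0" using orth[OF y] by simp
    from fun_cong[OF zero_sum_eq_zeroI[OF fin y this], of v] show ?thesis by simp
  qed
  define h where "h = (\<lambda>v. ?T f\<^sub>0 v + sqrt m * f\<^sub>0 v)"
  have f\<^sub>0_nz: "f\<^sub>0 \<noteq> (\<lambda>_. 0)" using norm by auto
  show thesis
  proof (cases "h = (\<lambda>_. 0)")
    case True
    have "?T f\<^sub>0 = (\<lambda>v. - sqrt m * f\<^sub>0 v)"
    proof
      fix v show "?T f\<^sub>0 v = - sqrt m * f\<^sub>0 v" using fun_cong[OF True, of v] by (simp add: h_def)
    qed
    then show thesis using f\<^sub>0W f\<^sub>0_nz bound m by (intro that[of f\<^sub>0 "- sqrt m"]) auto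
  next
    case False
    have "?T h = (\<lambda>v. sqrt m * h v)"
    proof
      fix v
      have "?T h v = m * f\<^sub>0 v + sqrt m * ?T f\<^sub>0 v"
        unfolding h_def by (simp add: kernel_operator_add_scaled TT)
      moreover have "m * f\<^sub>0 v = sqrt m * (sqrt m * f\<^sub>0 v)" using m by (simp add: mult.assoc[symmetric])
      ultimately show "?T h v = sqrt m * h v" by (simp add: h_def distrib_left)
    qed
    moreover have "h \<in> ?W" unfolding h_def using TW f\<^sub>0W by (intro zero_sum_functions_add_scaled) auto
    ultimately show thesis using False bound m by (intro that[of h "sqrt m"]) auto
  qed
qed

section \<open>The Laplacian spectrum\<close>

lemma sorted_nth_nonzero_index:
  assumes "sorted xs" "\<sigma> \<in> set xs" "z \<in> set xs" "z < \<sigma>"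
  obtains i where "0 < i" "i < length xs" "xs ! i = \<sigma>"
proof -
  obtain i j where ij: "i < length xs" "xs ! i = \<sigma>" "j < length xs" "xs ! j = z"
    using assms by (auto simp: in_set_conv_nth)
  have "i \<noteq> 0"
  proof
    assume "i = 0"
    then have "xs ! i \<le> xs ! j" using assms(1) ij by (intro sorted_nth_mono) auto
    then show False using assms ij by auto
  qed
  then show thesis using ij that by auto
qed

lemma multiple_nth_nonzero_index:
  assumes "2 \<le> count (mset xs) \<sigma>"
  obtains i where "0 < i" "i < length xs" "xs ! i = \<sigma>"
proof -
  have "\<sigma> \<in> set (tl xs)"
  proof (cases xs)
    case Nil
    then show ?thesis using assms by simp
  next
    case (Cons x ys)
    have "\<sigma> \<in> set ys"
    proof (rule ccontr)
      assume "\<sigma> \<notin> set ys"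
      then have "count (mset ys) \<sigma> = 0" by (simp only: count_mset_0_iff not_False_eq_True)
      moreover have "count (mset xs) \<sigma> \<le> Suc (count (mset ys) \<sigma>)" by (simp add: Cons)
      ultimately show False using assms by linarith
    qed
    then show ?thesis using Cons by simp
  qed
  then obtain i where "i < length (tl xs)" "tl xs ! i = \<sigma>" by (auto simp: in_set_conv_nth)
  then show thesis using that[of "Suc i"] by (cases xs) auto
qed

text \<open>
  Dropping the zero coordinate of \<open>z\<close> leaves a null vector of the minor.
\<close>
lemma det_mat_delete_eq_0:
  fixes A :: "'a :: idom mat"
  assumes A: "A \<in> carrier_mat n n" and i: "i < n" and z: "z \<in> carrier_vec n" "z \<noteq> 0\<^sub>v n" "A *\<^sub>v z = 0\<^sub>v n"
    and zi: "z $ i = 0"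
  shows "Determinant.det (mat_delete A i i) = 0"
proof -
  obtain m where n: "n = Suc m" using i by (cases n) auto
  define y where "y = Matrix.vec m (\<lambda>j. z $ insert_index i j)"
  have "Determinant.det (mat_delete A i i) = 0 \<longleftrightarrow>
    (\<exists>v. v \<in> carrier_vec m \<and> v \<noteq> 0\<^sub>v m \<and> mat_delete A i i *\<^sub>v v = 0\<^sub>v m)"
    using mat_delete_carrier[OF A, of i i] n by (intro det_0_iff_vec_prod_zero) simp
  moreover have "y \<in> carrier_vec m" by (simp add: y_def)
  moreover have "y \<noteq> 0\<^sub>v m"
  proof
    assume y: "y = 0\<^sub>v m"
    have "z $ j = 0" if "j < n" for j
    proof (cases "j = i")
      case False
      then obtain j' where j': "j' < m" "j = insert_index i j'"
        using \<open>j < n\<close> i n unfolding insert_index_def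
        by (cases "j < i") (auto intro: that[of j] that[of "j - 1"])
      have "y $ j' = 0" using y j' by simp
      then show ?thesis using j' by (simp add: y_def)
    qed (simp add: zi)
    then have "z = 0\<^sub>v n" using z(1) by auto
    then show False using z(2) by simp
  qed
  moreover have "mat_delete A i i *\<^sub>v y = 0\<^sub>v m"
  proof
    fix r assume "r < dim_vec (0\<^sub>v m :: 'a vec)"
    then have r: "r < m" by simp
    have r': "insert_index i r < n" using r n by (simp add: insert_index_def)
    have "(mat_delete A i i *\<^sub>v y) $ r = (\<Sum>j<m. A $$ (insert_index i r, insert_index i j) * z $ insert_index i j)"
      using r n A i by (simp add: scalar_prod_def y_def mat_delete_index[OF A[unfolded n]] atLeast0LessThan mat_delete_dim)
    also have "\<dots> = (\<Sum>j\<in>{..<n} - {i}. A $$ (insert_index i r, j) * z $ j)"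
    proof (rule sum.reindex_bij_betw)
      show "bij_betw (insert_index i) {..<m} ({..<n} - {i})"
        using insert_index_image[of i m] i n by (simp add: bij_betw_def insert_index_inj_on atLeast0LessThan)
    qed
    also have "\<dots> = (\<Sum>j<n. A $$ (insert_index i r, j) * z $ j)"
      using i zi by (simp add: sum.remove[of "{..<n}" i])
    also have "\<dots> = (A *\<^sub>v z) $ insert_index i r"
      using r' A z(1) by (simp add: scalar_prod_def atLeast0LessThan)
    also have "\<dots> = 0" using z(3) r' by simp
    finally show "(mat_delete A i i *\<^sub>v y) $ r = 0\<^sub>v m $ r" using r by simp
  qed (use A n in \<open>simp add: mat_delete_dim\<close>)
  ultimately show ?thesis by blast
qed

lemma char_matrix_0:
  assumes "A \<in> carrier_mat n n"
  shows "char_matrix A 0 = A"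
  using assms by (intro eq_matI) (auto simp: char_matrix_def)

text \<open>
  Two independent null vectors make \<open>0\<close> a double root: each principal minor of order \<open>n - 1\<close>
  vanishes, because a combination of the two null vectors has a zero in the deleted coordinate, and
  the derivative of the characteristic polynomial is the sum of the characteristic polynomials of
  the principal submatrices.
\<close>
lemma order_char_poly_0_ge_2:
  fixes A :: "real mat"
  assumes A: "A \<in> carrier_mat n n"
    and x: "x \<in> carrier_vec n" "A *\<^sub>v x = 0\<^sub>v n"
    and y: "y \<in> carrier_vec n" "y \<noteq> 0\<^sub>v n" "A *\<^sub>v y = 0\<^sub>v n"
    and indep: "\<And>i. i < n \<Longrightarrow> \<exists>j<n. x $ i * y $ j \<noteq> y $ i * x $ j"
  shows "2 \<le> order 0 (char_poly A)"
proof -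
  have minor: "poly (char_poly (mat_delete A i i)) 0 = 0" if i: "i < n" for i
  proof -
    \<comment> \<open>The combination of the two null vectors that vanishes at \<open>i\<close>.\<close>
    define z where "z = (- y $ i) \<cdot>\<^sub>v x + x $ i \<cdot>\<^sub>v y"
    obtain j where j: "j < n" "x $ i * y $ j \<noteq> y $ i * x $ j" using indep i by blast
    have z: "z \<in> carrier_vec n" using x y by (simp add: z_def)
    have zi: "z $ i = 0" using x y i by (simp add: z_def)
    have "z $ j \<noteq> 0" using x y j by (simp add: z_def)
    then have nz: "z \<noteq> 0\<^sub>v n" using j by auto
    have "A *\<^sub>v z = 0\<^sub>v n"
      unfolding z_def using A x y
      by (subst mult_add_distrib_mat_vec[OF A]) (auto simp: mult_mat_vec[OF A])
    from det_mat_delete_eq_0[OF A i z nz this zi]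
    have d: "Determinant.det (mat_delete A i i) = 0" .
    have c: "mat_delete A i i \<in> carrier_mat (n - 1) (n - 1)" using mat_delete_carrier[OF A] .
    have "char_matrix (mat_delete A i i) 0 = mat_delete A i i"
      using c by (rule char_matrix_0)
    then have "eigenvalue (mat_delete A i i) 0 \<longleftrightarrow> Determinant.det (mat_delete A i i) = 0"
      by (simp add: eigenvalue_det[OF c])
    then show ?thesis using d eigenvalue_root_char_poly[OF c] by simp
  qed
  have "poly (pderiv (char_poly A)) 0 = 0"
    unfolding pderiv_char_poly[OF A] poly_sum using minor by simp
  moreover have "eigenvalue A 0"
    unfolding eigenvalue_def eigenvector_def using A y by (intro exI[of _ y]) auto
  then have "poly (char_poly A) 0 = 0" using eigenvalue_root_char_poly[OF A] by simp
  moreover have "char_poly A \<noteq> 0" using degree_monic_char_poly[OF A] by auto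
  moreover have "pderiv (char_poly A) \<noteq> 0"
  proof
    assume "pderiv (char_poly A) = 0"
    then have "degree (char_poly A) = 0" by (simp add: pderiv_eq_0_iff)
    then obtain c where "char_poly A = [:c:]" by (auto elim: degree_eq_zeroE)
    then show False using \<open>poly (char_poly A) 0 = 0\<close> \<open>char_poly A \<noteq> 0\<close> by simp
  qed
  ultimately show ?thesis
    using order_pderiv[of "char_poly A" 0] order_root[of "pderiv (char_poly A)" 0] by simp
qed

text \<open>
  The entries of \<open>d - L\<close>, indexed by the vertices themselves instead of their positions.
\<close>
definition shifted_kernel :: "('a, 'b) pre_digraph \<Rightarrow> real \<Rightarrow> 'a \<Rightarrow> 'a \<Rightarrow> real" where
  "shifted_kernel G d v w =
     (if v = w then d - real (out_degree G v) else 0) + (if v \<rightarrow>\<^bsub>G\<^esub> w then 1 else 0)"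

context graph begin

lemma out_degree_eq_card: "out_degree G v = card {w \<in> verts G. v \<rightarrow> w}"
proof -
  have "inj_on (head G) (out_arcs G v)"
    by (rule inj_onI) (auto intro!: no_multi_arcs simp: arc_to_ends_def)
  moreover have "head G ` out_arcs G v = {w \<in> verts G. v \<rightarrow> w}"
    by (auto simp: arcs_ends_conv)
  ultimately show ?thesis by (simp add: out_degree_def card_image[symmetric])
qed

lemma adj_sym: "v \<rightarrow> w \<longleftrightarrow> w \<rightarrow> v"
  using graph_symmetric by blast

lemma shifted_kernel_sym: "shifted_kernel G d v w = shifted_kernel G d w v"
  by (auto simp: shifted_kernel_def adj_sym)

lemma sum_adj_eq: "(\<Sum>w\<in>verts G. if v \<rightarrow> w then f w else (0::real)) = (\<Sum>w | w \<in> verts G \<and> v \<rightarrow> w. f w)"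
  by (rule sum.inter_filter[symmetric]) simp

lemma kernel_operator_shifted:
  assumes v: "v \<in> verts G"
  shows "kernel_operator (verts G) (shifted_kernel G d) f v =
    (d - real (out_degree G v)) * f v + (\<Sum>w | w \<in> verts G \<and> v \<rightarrow> w. f w)"
proof -
  have "kernel_operator (verts G) (shifted_kernel G d) f v =
     (\<Sum>w\<in>verts G. (if v = w then (d - real (out_degree G v)) * f w else 0)) +
     (\<Sum>w\<in>verts G. if v \<rightarrow> w then f w else 0)"
    unfolding kernel_operator_def shifted_kernel_def sum.distrib[symmetric] if_P[OF v]
    by (intro sum.cong refl) (auto simp: distrib_right)
  then show ?thesis using v by (simp add: sum_adj_eq)
qed

lemma shifted_kernel_row_sum:
  assumes "v \<in> verts G" shows "(\<Sum>w\<in>verts G. shifted_kernel G d v w) = d"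
  using kernel_operator_shifted[OF assms, of d "\<lambda>_. 1"] assms
  by (simp add: kernel_operator_def out_degree_eq_card)

lemma laplacian_quadratic_form:
  "(\<Sum>v\<in>verts G. f v * kernel_operator (verts G) (shifted_kernel G 0) f v) =
    - (\<Sum>v\<in>verts G. \<Sum>w | w \<in> verts G \<and> v \<rightarrow> w. (f v - f w)\<^sup>2) / 2"
proof -
  let ?N = "\<lambda>v. {w \<in> verts G. v \<rightarrow> w}"
  have swap: "(\<Sum>v\<in>verts G. \<Sum>w\<in>?N v. (f w)\<^sup>2) = (\<Sum>v\<in>verts G. \<Sum>w\<in>?N v. (f v)\<^sup>2)"
  proof -
    have "(\<Sum>v\<in>verts G. \<Sum>w\<in>?N v. (f w)\<^sup>2) = (\<Sum>v\<in>verts G. \<Sum>w\<in>verts G. if v \<rightarrow> w then (f w)\<^sup>2 else 0)"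
      by (simp add: sum_adj_eq)
    also have "\<dots> = (\<Sum>w\<in>verts G. \<Sum>v\<in>verts G. if w \<rightarrow> v then (f w)\<^sup>2 else 0)"
      by (subst sum.swap) (simp only: adj_sym)
    also have "\<dots> = (\<Sum>w\<in>verts G. \<Sum>v\<in>?N w. (f w)\<^sup>2)"
      by (simp add: sum_adj_eq)
    finally show ?thesis .
  qed
  have "(\<Sum>v\<in>verts G. \<Sum>w\<in>?N v. (f v - f w)\<^sup>2) =
      (\<Sum>v\<in>verts G. \<Sum>w\<in>?N v. (f v)\<^sup>2) + (\<Sum>v\<in>verts G. \<Sum>w\<in>?N v. (f w)\<^sup>2)
      - 2 * (\<Sum>v\<in>verts G. \<Sum>w\<in>?N v. f v * f w)"
    by (simp only: power2_diff sum.distrib sum_subtractf sum_distrib_left mult.assoc)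
  also have "\<dots> = 2 * (\<Sum>v\<in>verts G. f v * (real (out_degree G v) * f v - (\<Sum>w\<in>?N v. f w)))"
    unfolding swap by (simp add: out_degree_eq_card right_diff_distrib sum_subtractf sum_distrib_left power2_eq_square algebra_simps)
  also have "(\<Sum>v\<in>verts G. f v * (real (out_degree G v) * f v - (\<Sum>w\<in>?N v. f w)))
     = - (\<Sum>v\<in>verts G. f v * kernel_operator (verts G) (shifted_kernel G 0) f v)"
    unfolding sum_negf[symmetric] by (intro sum.cong refl) (simp add: kernel_operator_shifted algebra_simps)
  finally show ?thesis by simp
qed

end

lemma laplacian_mult_vec:
  fixes G :: "('a :: linorder, 'b) pre_digraph"
  assumes "graph G"
  shows "laplacian G *\<^sub>v Matrix.vec (card (verts G)) (\<lambda>i. f (vertex_list G ! i)) =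
    Matrix.vec (card (verts G)) (\<lambda>i. - kernel_operator (verts G) (shifted_kernel G 0) f (vertex_list G ! i))"
proof
  interpret graph G by fact
  let ?n = "card (verts G)" and ?l = "vertex_list G"
  fix i assume "i < dim_vec (Matrix.vec ?n (\<lambda>i. - kernel_operator (verts G) (shifted_kernel G 0) f (?l ! i)))"
  then have i: "i < ?n" by simp
  have dist: "distinct ?l" and set: "set ?l = verts G" and len: "length ?l = ?n"
    by (auto simp: vertex_list_def)
  have bij: "bij_betw ((!) ?l) {..<?n} (verts G)"
    using bij_betw_nth[OF dist] len set by simp
  have "(laplacian G *\<^sub>v Matrix.vec ?n (\<lambda>i. f (?l ! i))) $ i =
    (\<Sum>j<?n. - shifted_kernel G 0 (?l ! i) (?l ! j) * f (?l ! j))"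
    using i dist len
    by (auto simp: scalar_prod_def laplacian_def degree_mat_def adjacency_mat_def shifted_kernel_def
        atLeast0LessThan nth_eq_iff_index_eq intro!: sum.cong)
  also have "\<dots> = - (\<Sum>w\<in>verts G. shifted_kernel G 0 (?l ! i) w * f w)"
    using sum.reindex_bij_betw[OF bij, of "\<lambda>w. - shifted_kernel G 0 (?l ! i) w * f w"]
    by (simp add: sum_negf)
  finally show "(laplacian G *\<^sub>v Matrix.vec ?n (\<lambda>i. f (?l ! i))) $ i =
    Matrix.vec ?n (\<lambda>i. - kernel_operator (verts G) (shifted_kernel G 0) f (?l ! i)) $ i"
    using i len set nth_mem[of i ?l] by (simp add: kernel_operator_def)
qed (simp add: laplacian_def degree_mat_def adjacency_mat_def)

lemma laplacian_carrier: "laplacian G \<in> carrier_mat (card (verts G)) (card (verts G))"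
  unfolding laplacian_def degree_mat_def adjacency_mat_def by (intro minus_carrier_mat) simp

lemma length_laplacian_spectrum_le: "length (laplacian_spectrum G) \<le> card (verts G)"
proof -
  have "length (laplacian_spectrum G) = size (proots (char_poly (laplacian G)))"
    unfolding laplacian_spectrum_def by (metis mset_sorted_list_of_multiset size_mset)
  also have "\<dots> \<le> card (verts G)"
    using size_proots_le[of "char_poly (laplacian G)"] degree_monic_char_poly[OF laplacian_carrier[of G]] by simp
  finally show ?thesis .
qed

lemma finite_theta_set: "finite {\<bar>avg_degree G - laplacian_spectrum G ! i\<bar> | i. 0 < i \<and> i < card (verts G)}"
  by (rule finite_image_set) simp

lemma theta_nonneg: 
  assumes "2 \<le> card (verts G)"
  shows "0 \<le> theta G"
proof -
  have "\<bar>avg_degree G - laplacian_spectrum G ! 1\<bar> \<le> theta G"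
    unfolding theta_def using assms by (intro Max_ge finite_theta_set) auto
  then show ?thesis by linarith
qed

text \<open>
  The maximum defining \<open>theta\<close> ranges over the spectrum without its first entry, so the point is
  that the eigenvalue \<open>\<sigma> = d - \<mu>\<close> of a sum-zero function occurs at a positive index. For
  \<open>\<sigma> > 0\<close> this holds because the eigenvalue \<open>0\<close> of the constants is listed earlier. For \<open>\<sigma> = 0\<close>
  the constants and the given function are independent null vectors, so \<open>0\<close> is listed twice.
\<close>
lemma abs_eigenvalue_le_theta:
  fixes G :: "('a :: linorder, 'b) pre_digraph"
  assumes "graph G" and card: "2 \<le> card (verts G)"
    and f: "f \<in> zero_sum_functions (verts G)" "f \<noteq> (\<lambda>_. 0)"
    and eig: "kernel_operator (verts G) (shifted_kernel G (avg_degree G)) f = (\<lambda>v. \<mu> * f v)"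
  shows "\<bar>\<mu>\<bar> \<le> theta G"
proof -
  interpret graph G by fact
  let ?n = "card (verts G)" and ?l = "vertex_list G" and ?L = "laplacian G"
  let ?vec = "\<lambda>f. Matrix.vec ?n (\<lambda>i. f (?l ! i))"
  define one fvec :: "real vec" where "one = ?vec (\<lambda>_. 1)" and "fvec = ?vec f"
  have one: "one $ i = 1" and fvec: "fvec $ i = f (?l ! i)" if "i < ?n" for i
    using that by (simp_all add: one_def fvec_def)
  have one_carrier: "one \<in> carrier_vec ?n" and fvec_carrier: "fvec \<in> carrier_vec ?n"
    by (simp_all add: one_def fvec_def)
  define \<sigma> where "\<sigma> = avg_degree G - \<mu>"
  have set: "set ?l = verts G" and len: "length ?l = ?n"
    by (auto simp: vertex_list_def)
  have L0: "kernel_operator (verts G) (shifted_kernel G 0) f v = - \<sigma> * f v" if "v \<in> verts G" for v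
    using fun_cong[OF eig, of v] that by (simp add: kernel_operator_shifted \<sigma>_def algebra_simps)
  obtain v\<^sub>0 where v\<^sub>0: "v\<^sub>0 \<in> verts G" "f v\<^sub>0 \<noteq> 0"
    using f by (auto simp: zero_sum_functions_def fun_eq_iff)
  then obtain i\<^sub>0 where i\<^sub>0: "i\<^sub>0 < ?n" "f (?l ! i\<^sub>0) \<noteq> 0" using set len by (metis in_set_conv_nth)
  have Lf: "?L *\<^sub>v fvec = \<sigma> \<cdot>\<^sub>v fvec"
    unfolding fvec_def laplacian_mult_vec[OF \<open>graph G\<close>] using L0 set len nth_mem[of _ ?l] by auto
  have L1: "?L *\<^sub>v one = 0\<^sub>v ?n"
    unfolding one_def laplacian_mult_vec[OF \<open>graph G\<close>, of "\<lambda>_. 1"]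
  proof
    fix i assume "i < dim_vec (0\<^sub>v ?n :: real vec)"
    then have i: "i < ?n" by simp
    then have "?l ! i \<in> verts G" using set len nth_mem by metis
    then have "kernel_operator (verts G) (shifted_kernel G 0) (\<lambda>_. 1) (?l ! i) = 0"
      by (simp add: kernel_operator_shifted out_degree_eq_card)
    then show "?vec (\<lambda>v. - kernel_operator (verts G) (shifted_kernel G 0) (\<lambda>_. 1) v) $ i = 0\<^sub>v ?n $ i"
      using i by simp
  qed simp
  then have L1': "?L *\<^sub>v one = 0 \<cdot>\<^sub>v one"
    using one_carrier by (intro eq_vecI) auto
  have f_nz: "fvec \<noteq> 0\<^sub>v ?n" 
  proof
    assume "fvec = 0\<^sub>v ?n"
    then have "fvec $ i\<^sub>0 = 0\<^sub>v ?n $ i\<^sub>0" by (simp only:)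
    then show False using i\<^sub>0 by (simp add: one fvec)
  qed
  have one_nz: "one \<noteq> 0\<^sub>v ?n" 
  proof
    assume "one = 0\<^sub>v ?n"
    then have "one $ i\<^sub>0 = 0\<^sub>v ?n $ i\<^sub>0" by (simp only:)
    then show False using i\<^sub>0 by (simp add: one fvec)
  qed
  have dimL: "dim_row ?L = ?n" using laplacian_carrier[of G] by simp
  have p_nz: "char_poly ?L \<noteq> 0" using degree_monic_char_poly[OF laplacian_carrier[of G]] by auto
  have spec: "mset (laplacian_spectrum G) = proots (char_poly ?L)"
    by (simp add: laplacian_spectrum_def)
  have "eigenvalue ?L \<sigma>"
    unfolding eigenvalue_def eigenvector_def dimL by (intro exI[of _ "fvec"]) (simp add: Lf f_nz fvec_carrier)
  moreover have "eigenvalue ?L 0"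
    unfolding eigenvalue_def eigenvector_def dimL
    by (intro exI[of _ "one"]) (simp add: L1' one_nz one_carrier)
  ultimately have "\<sigma> \<in># proots (char_poly ?L)" "0 \<in># proots (char_poly ?L)"
    using p_nz by (simp_all add: eigenvalue_root_char_poly[OF laplacian_carrier])
  then have in_spec: "\<sigma> \<in> set (laplacian_spectrum G)" "0 \<in> set (laplacian_spectrum G)"
    unfolding spec[symmetric] by auto
  have "\<sigma> \<ge> 0"
  proof -
    have "- \<sigma> * (\<Sum>v\<in>verts G. (f v)\<^sup>2) = (\<Sum>v\<in>verts G. f v * kernel_operator (verts G) (shifted_kernel G 0) f v)"
      unfolding sum_distrib_left by (intro sum.cong refl) (simp add: L0 power2_eq_square)
    also have "\<dots> \<le> 0" unfolding laplacian_quadratic_form by (simp add: sum_nonneg)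
    finally have "0 \<le> \<sigma> * (\<Sum>v\<in>verts G. (f v)\<^sup>2)" by simp
    moreover have "(\<Sum>v\<in>verts G. (f v)\<^sup>2) > 0" using v\<^sub>0 by (intro sum_pos2[of _ v\<^sub>0]) auto
    ultimately show ?thesis by (simp add: zero_le_mult_iff)
  qed
  obtain i where i: "0 < i" "i < length (laplacian_spectrum G)" "laplacian_spectrum G ! i = \<sigma>"
  proof (cases "\<sigma> = 0")
    case False
    then have pos: "0 < \<sigma>" using \<open>\<sigma> \<ge> 0\<close> by simp
    have sorted: "sorted (laplacian_spectrum G)" by (simp add: laplacian_spectrum_def)
    show ?thesis by (rule sorted_nth_nonzero_index[OF sorted in_spec pos]) (rule that)
  next
    case True
    have indep: "\<exists>j<?n. one $ i * fvec $ j \<noteq> fvec $ i * one $ j" if i: "i < ?n" for i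
    proof (rule ccontr)
      assume *: "\<not> (\<exists>j<?n. one $ i * fvec $ j \<noteq> fvec $ i * one $ j)"
      have c: "f (?l ! j) = f (?l ! i)" if j: "j < ?n" for j
      proof -
        have "one $ i * fvec $ j = fvec $ i * one $ j" using * j by blast
        then show ?thesis using i j by (simp add: one fvec)
      qed
      have "f v = f (?l ! i)" if v: "v \<in> verts G" for v
      proof -
        obtain j where "j < ?n" "?l ! j = v" using v set len by (metis in_set_conv_nth)
        then show ?thesis using c by blast
      qed
      then have "sum f (verts G) = (\<Sum>v\<in>verts G. f (?l ! i))" by (intro sum.cong refl)
      also have "\<dots> = real ?n * f (?l ! i)" by simp
      finally have "f (?l ! i) = 0" using f(1) v\<^sub>0(1) by (auto simp: zero_sum_functions_def)
      then show False using c[OF i\<^sub>0(1)] i\<^sub>0(2) by simp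
    qed
    have "?L *\<^sub>v fvec = 0\<^sub>v ?n" unfolding Lf True using fvec_carrier by (intro eq_vecI) auto
    then have "2 \<le> order 0 (char_poly ?L)"
      by (rule order_char_poly_0_ge_2[OF laplacian_carrier one_carrier L1 fvec_carrier f_nz _ indep])
    then have "2 \<le> count (mset (laplacian_spectrum G)) \<sigma>" using True p_nz by (simp add: spec)
    then show ?thesis by (rule multiple_nth_nonzero_index) (rule that)
  qed
  have "\<bar>avg_degree G - \<sigma>\<bar> \<le> theta G"
    unfolding theta_def using i length_laplacian_spectrum_le[of G] by (intro Max_ge finite_theta_set) auto
  then show ?thesis by (simp add: \<sigma>_def)
qed

lemma avg_degree_le:
  assumes "verts G \<noteq> {}" "finite (verts G)" "\<And>v. v \<in> verts G \<Longrightarrow> out_degree G v \<le> B"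
  shows "avg_degree G \<le> real B"
proof -
  have "(\<Sum>v\<in>verts G. real (out_degree G v)) \<le> (\<Sum>v\<in>verts G. real B)"
    using assms(3) by (intro sum_mono) simp
  then show ?thesis using assms(1,2) by (simp add: avg_degree_def field_simps card_gt_0_iff)
qed

section \<open>Neighbourhoods in graphs with a contracting Laplacian\<close>

text \<open>
  What the spectrum contributes, freed from matrices: \<open>d - L\<close> contracts the sum-zero functions by
  the factor \<open>\<theta> < d\<close>.
\<close>
locale contracting_graph = graph G for G :: "('a, 'b) pre_digraph" (structure) +
  fixes d \<theta> :: real
  assumes theta_nonneg: "0 \<le> \<theta>" and theta_less: "\<theta> < d"
    and contraction: "g \<in> zero_sum_functions (verts G) \<Longrightarrow>
      (\<Sum>v\<in>verts G. (kernel_operator (verts G) (shifted_kernel G d) g v)\<^sup>2) \<le> \<theta>\<^sup>2 * (\<Sum>v\<in>verts G. (g v)\<^sup>2)"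
begin

abbreviation T :: "('a \<Rightarrow> real) \<Rightarrow> 'a \<Rightarrow> real" where
  "T \<equiv> kernel_operator (verts G) (shifted_kernel G d)"

lemma sum_T: "sum (T f) (verts G) = d * sum f (verts G)"
  using shifted_kernel_sym shifted_kernel_row_sum by (rule sum_kernel_operator)

lemma T_symmetric: "(\<Sum>v\<in>verts G. T f v * g v) = (\<Sum>v\<in>verts G. f v * T g v)"
  by (rule kernel_operator_symmetric) (rule shifted_kernel_sym)

lemma theta_sq_less: "\<theta>\<^sup>2 < d\<^sup>2"
  using theta_nonneg theta_less by (intro power_strict_mono) auto

text \<open>
  Split off the constant part of \<open>g\<close>; it is an eigenfunction for the eigenvalue \<open>d\<close> and orthogonal
  to the rest.
\<close>
lemma norm_T_le:
  assumes "card (verts G) > 0"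
  shows "(\<Sum>v\<in>verts G. (T g v)\<^sup>2) \<le> \<theta>\<^sup>2 * (\<Sum>v\<in>verts G. (g v)\<^sup>2)
    + (d\<^sup>2 - \<theta>\<^sup>2) * (sum g (verts G))\<^sup>2 / real (card (verts G))"
proof -
  define n where "n = real (card (verts G))"
  have n: "n > 0" using assms by (simp add: n_def)
  define m where "m = sum g (verts G) / n"
  define h where "h v = (if v \<in> verts G then g v - m else 0)" for v
  have h: "h \<in> zero_sum_functions (verts G)"
    using n by (simp add: zero_sum_functions_def h_def sum_subtractf m_def n_def)
  have sum_h: "sum h (verts G) = 0" using h by (simp add: zero_sum_functions_def)
  have "T g = T (\<lambda>v. h v + m * 1)"
    unfolding kernel_operator_def h_def by (intro ext if_cong refl sum.cong) auto
  moreover have "T (\<lambda>_. 1) v = d" if "v \<in> verts G" for v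
    using that shifted_kernel_row_sum by (simp add: kernel_operator_def)
  ultimately have Tg: "T g v = T h v + m * d" if "v \<in> verts G" for v
    using that by (simp only: kernel_operator_add_scaled)
  have g: "g v = h v + m" if "v \<in> verts G" for v using that by (simp add: h_def)
  have nm: "n * m\<^sup>2 = (sum g (verts G))\<^sup>2 / n" using n by (simp add: m_def power2_eq_square)
  have "(\<Sum>v\<in>verts G. (T g v)\<^sup>2) = (\<Sum>v\<in>verts G. (T h v)\<^sup>2 + 2 * (m * d) * T h v + (m * d)\<^sup>2)"
    by (intro sum.cong refl) (simp add: Tg power2_sum algebra_simps)
  also have "\<dots> = (\<Sum>v\<in>verts G. (T h v)\<^sup>2) + 2 * (m * d) * sum (T h) (verts G) + n * (m * d)\<^sup>2"
    by (simp only: sum.distrib sum_distrib_left) (simp add: n_def)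
  also have "\<dots> = (\<Sum>v\<in>verts G. (T h v)\<^sup>2) + d\<^sup>2 * (n * m\<^sup>2)"
    unfolding sum_T sum_h by (simp add: power_mult_distrib)
  also have "\<dots> \<le> \<theta>\<^sup>2 * (\<Sum>v\<in>verts G. (h v)\<^sup>2) + d\<^sup>2 * (n * m\<^sup>2)"
    using contraction[OF h] by simp
  also have "(\<Sum>v\<in>verts G. (h v)\<^sup>2) = (\<Sum>v\<in>verts G. (g v)\<^sup>2) - n * m\<^sup>2"
  proof -
    have "(\<Sum>v\<in>verts G. (g v)\<^sup>2) = (\<Sum>v\<in>verts G. (h v)\<^sup>2 + 2 * m * h v + m\<^sup>2)"
      by (intro sum.cong refl) (simp add: g power2_sum)
    also have "\<dots> = (\<Sum>v\<in>verts G. (h v)\<^sup>2) + 2 * m * sum h (verts G) + n * m\<^sup>2"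
      by (simp only: sum.distrib sum_distrib_left) (simp add: n_def)
    finally show ?thesis by (simp add: sum_h)
  qed
  finally show ?thesis by (simp add: nm n_def[symmetric] algebra_simps diff_divide_distrib)
qed

context
  fixes U :: "'a set" and x :: "'a \<Rightarrow> real" and N :: "'a set" and u w n :: real
  assumes U: "U \<subseteq> verts G" and U_ne: "U \<noteq> {}"
  defines "x \<equiv> \<lambda>v. of_bool (v \<in> U)"
    and "N \<equiv> neighborhood G U"
    and "u \<equiv> real (card U)" and "w \<equiv> real (card (neighborhood G U))" and "n \<equiv> real (card (verts G))"
begin

lemma finite_U: "finite U" using U finite_subset finite_verts by blast

lemma u_pos: "u > 0" using finite_U U_ne by (simp add: u_def card_gt_0_iff)

lemma card_verts_pos: "card (verts G) > 0" using U U_ne by (auto simp: card_gt_0_iff)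

lemma sum_x: "sum x (verts G) = u" "(\<Sum>v\<in>verts G. (x v)\<^sup>2) = u"
proof -
  have "verts G \<inter> U = U" using U by blast
  then show "sum x (verts G) = u"
    by (simp add: x_def u_def of_bool_def sum.If_cases Int_def Collect_mem_eq)
  moreover have "(\<Sum>v\<in>verts G. (x v)\<^sup>2) = sum x (verts G)"
    by (intro sum.cong) (simp_all add: x_def)
  ultimately show "(\<Sum>v\<in>verts G. (x v)\<^sup>2) = u" by simp
qed

lemma T_x_outside:
  assumes "v \<in> verts G" "v \<notin> U"
  shows "T x v = real (card {w \<in> U. v \<rightarrow> w})"
proof -
  have "T x v = (\<Sum>w | w \<in> verts G \<and> v \<rightarrow> w. x w)"
    using assms by (simp add: kernel_operator_shifted x_def)
  also have "\<dots> = (\<Sum>w\<in>{w \<in> U. v \<rightarrow> w}. 1)"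
    using U unfolding x_def of_bool_def by (intro sum.mono_neutral_cong_right) auto
  finally show ?thesis by simp
qed

lemma T_x_eq_0:
  assumes "v \<notin> U \<union> N"
  shows "T x v = 0"
proof (cases "v \<in> verts G")
  case True
  then have "{w \<in> U. v \<rightarrow> w} = {}" using assms by (auto simp: N_def neighborhood_def)
  moreover have "T x v = real (card {w \<in> U. v \<rightarrow> w})" using True assms by (intro T_x_outside) auto
  ultimately show ?thesis by (simp only: card.empty of_nat_0)
qed (simp add: kernel_operator_def)

lemma T_x_ge_1:
  assumes "v \<in> N"
  shows "1 \<le> T x v"
proof -
  have v: "v \<in> verts G" "v \<notin> U" "{w \<in> U. v \<rightarrow> w} \<noteq> {}"
    using assms by (auto simp: N_def neighborhood_def)
  then have "card {w \<in> U. v \<rightarrow> w} > 0" using finite_U by (simp add: card_gt_0_iff)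
  then show ?thesis unfolding T_x_outside[OF v(1,2)] by simp
qed

text \<open>
  The Cauchy-Schwarz inequality on the support \<open>U \<union> N\<close> of \<open>T x\<close>.
\<close>
lemma square_mass_le: "(d * u)\<^sup>2 \<le> (u + w) * (\<Sum>v\<in>verts G. (T x v)\<^sup>2)"
proof -
  have N: "N \<subseteq> verts G" "U \<inter> N = {}" by (auto simp: N_def neighborhood_def)
  then have fin: "finite N" using finite_subset finite_verts by blast
  have card: "real (card (U \<union> N)) = u + w"
    using finite_U fin N by (simp add: card_Un_disjoint u_def w_def N_def)
  have "d * u = sum (T x) (verts G)" by (simp add: sum_T sum_x)
  also have "\<dots> = sum (T x) (U \<union> N)"
    using U N by (intro sum.mono_neutral_right) (auto intro: T_x_eq_0)
  finally have "(d * u)\<^sup>2 = (sum (T x) (U \<union> N))\<^sup>2" by simp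
  also have "\<dots> \<le> (\<Sum>v\<in>U \<union> N. (T x v)\<^sup>2) * real (card (U \<union> N))"
    by (rule sum_squared_le_sum_of_squares)
  also have "(\<Sum>v\<in>U \<union> N. (T x v)\<^sup>2) = (\<Sum>v\<in>verts G. (T x v)\<^sup>2)"
    using U N by (intro sum.mono_neutral_left) (auto intro: T_x_eq_0)
  finally show ?thesis unfolding card by (simp add: mult.commute)
qed

lemma card_neighborhood_ge:
  assumes half: "u \<le> n / 2"
  shows "(d\<^sup>2 - \<theta>\<^sup>2) / (2 * d\<^sup>2) * u \<le> w"
proof -
  define \<rho> where "\<rho> = \<theta>\<^sup>2 + (d\<^sup>2 - \<theta>\<^sup>2) * (u / n)"
  have n: "n > 0" using card_verts_pos by (simp add: n_def)
  have d: "d > 0" using theta_nonneg theta_less by linarith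
  have "(\<Sum>v\<in>verts G. (T x v)\<^sup>2) \<le> \<theta>\<^sup>2 * u + (d\<^sup>2 - \<theta>\<^sup>2) * u\<^sup>2 / n"
    using norm_T_le[OF card_verts_pos, of x] unfolding sum_x n_def[symmetric] .
  also have "\<dots> = u * \<rho>" by (simp add: \<rho>_def power2_eq_square algebra_simps diff_divide_distrib)
  finally have "(u + w) * (\<Sum>v\<in>verts G. (T x v)\<^sup>2) \<le> (u + w) * (u * \<rho>)"
    by (intro mult_left_mono) (auto simp: u_def w_def)
  then have "(d * u)\<^sup>2 \<le> (u + w) * (u * \<rho>)" using square_mass_le by linarith
  then have "u * (d\<^sup>2 * u) \<le> u * ((u + w) * \<rho>)" by (simp add: power2_eq_square algebra_simps)
  then have *: "d\<^sup>2 * u \<le> (u + w) * \<rho>" using u_pos by simp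
  have "(d\<^sup>2 - \<theta>\<^sup>2) * (u / n) \<le> (d\<^sup>2 - \<theta>\<^sup>2) * (1 / 2)"
    using half n theta_sq_less by (intro mult_left_mono) (auto simp: field_simps)
  then have \<rho>: "\<rho> \<le> (d\<^sup>2 + \<theta>\<^sup>2) / 2" by (simp add: \<rho>_def field_simps)
  have "(u + w) * \<rho> \<le> u * ((d\<^sup>2 + \<theta>\<^sup>2) / 2) + w * d\<^sup>2"
    using \<rho> theta_sq_less u_pos unfolding distrib_right
    by (intro add_mono mult_left_mono) (auto simp: w_def)
  with * have "d\<^sup>2 * u \<le> u * ((d\<^sup>2 + \<theta>\<^sup>2) / 2) + w * d\<^sup>2" by (rule order_trans)
  then have "(d\<^sup>2 - \<theta>\<^sup>2) * u \<le> 2 * d\<^sup>2 * w" by (simp add: field_simps)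
  then show ?thesis using d by (simp add: field_simps)
qed

text \<open>
  The norm of \<open>T\<^sup>2 x - \<theta>\<^sup>2 x\<close> is estimated in two ways. It is at least \<open>1\<close>, because at a vertex \<open>v\<close>
  at distance two from \<open>U\<close> the function \<open>x\<close> vanishes and \<open>T\<^sup>2 x\<close> adds up the values of \<open>T x\<close> at the
  neighbours of \<open>v\<close>, which are counts of edges into \<open>U\<close>, one of them positive. Expanding the square,
  it is at most \<open>\<theta>\<^sup>2 (\<theta>\<^sup>2 u - \<parallel>T x\<parallel>\<^sup>2)\<close> up to the constant part.
\<close>
lemma second_neighborhood_gap:
  assumes far: "neighborhood G (U \<union> neighborhood G U) \<noteq> {}"
  shows "1 \<le> \<theta>\<^sup>2 * (\<theta>\<^sup>2 * u - d\<^sup>2 * u\<^sup>2 / (u + w)) + (d\<^sup>2 - \<theta>\<^sup>2) * (d\<^sup>2 * u\<^sup>2) / n"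
proof -
  obtain v z where v: "v \<in> verts G" "v \<notin> U" "v \<notin> N" and z: "z \<in> U \<union> N" "v \<rightarrow> z"
    using far by (auto simp: neighborhood_def N_def)
  define Q where "Q = (\<Sum>v\<in>verts G. (T x v)\<^sup>2)"
  define y where "y = (\<lambda>v. T (T x) v - \<theta>\<^sup>2 * x v)"
  have not_U: "t \<notin> U" if "v \<rightarrow> t" for t
    using v that by (auto simp: N_def neighborhood_def)
  then have zN: "z \<in> N" using z by blast
  have "1 \<le> T x z" using T_x_ge_1[OF zN] .
  also have "T x z \<le> (\<Sum>t | t \<in> verts G \<and> v \<rightarrow> t. T x t)"
  proof (rule member_le_sum)
    show "z \<in> {t. t \<in> verts G \<and> v \<rightarrow> t}" using z adj_in_verts by blast
    show "0 \<le> T x t" if "t \<in> {t. t \<in> verts G \<and> v \<rightarrow> t} - {z}" for t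
      using that not_U by (simp add: T_x_outside)
  qed auto
  also have "\<dots> = y v"
    using v T_x_eq_0[of v] by (simp add: y_def kernel_operator_shifted[OF v(1), of d "T x"]) (simp add: x_def)
  finally have "1 \<le> y v" .
  then have "1 \<le> (y v)\<^sup>2" by (simp add: power2_eq_square mult_ge1_I)
  also have "\<dots> \<le> (\<Sum>v\<in>verts G. (y v)\<^sup>2)"
    using v(1) by (intro member_le_sum) auto
  also have "\<dots> = (\<Sum>v\<in>verts G. (T (T x) v)\<^sup>2) - 2 * \<theta>\<^sup>2 * (\<Sum>v\<in>verts G. T (T x) v * x v)
      + \<theta>\<^sup>2 * \<theta>\<^sup>2 * (\<Sum>v\<in>verts G. (x v)\<^sup>2)"
    unfolding y_def sum_distrib_left sum_subtractf[symmetric] sum.distrib[symmetric]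
    by (intro sum.cong refl) (simp add: power2_diff power2_eq_square algebra_simps)
  also have "(\<Sum>v\<in>verts G. T (T x) v * x v) = Q"
    using T_symmetric[of "T x" x] by (simp add: Q_def power2_eq_square)
  also have "(\<Sum>v\<in>verts G. (x v)\<^sup>2) = u" by (rule sum_x)
  finally have "1 \<le> (\<Sum>v\<in>verts G. (T (T x) v)\<^sup>2) - 2 * \<theta>\<^sup>2 * Q + \<theta>\<^sup>2 * \<theta>\<^sup>2 * u" .
  moreover have "(\<Sum>v\<in>verts G. (T (T x) v)\<^sup>2) \<le> \<theta>\<^sup>2 * Q + (d\<^sup>2 - \<theta>\<^sup>2) * (d\<^sup>2 * u\<^sup>2) / n"
    using norm_T_le[OF card_verts_pos, of "T x"]
    by (simp add: Q_def sum_T sum_x n_def power_mult_distrib)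
  moreover have "\<theta>\<^sup>2 * (d\<^sup>2 * u\<^sup>2 / (u + w)) \<le> \<theta>\<^sup>2 * Q"
  proof (rule mult_left_mono)
    have "u + w > 0" using u_pos by (simp add: w_def)
    then show "d\<^sup>2 * u\<^sup>2 / (u + w) \<le> Q"
      using square_mass_le by (simp add: Q_def field_simps power_mult_distrib)
  qed simp
  ultimately show ?thesis by (simp add: algebra_simps)
qed

text \<open>
  For bounded sets in large graphs the constant part is at most \<open>1 / 2\<close>, so at least half of the
  gap remains. The constant \<open>1 / (2 B\<^sup>4)\<close> depends only on the degree bound; this is what makes the
  union bound over small sets tend to zero even if \<open>1 / \<alpha>\<close> is an integer.
\<close>
lemma card_neighborhood_ge_strict:
  assumes far: "neighborhood G (U \<union> neighborhood G U) \<noteq> {}"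
    and dB: "d \<le> B" and uk: "u \<le> k" and nk: "2 * B ^ 4 * k\<^sup>2 \<le> n"
  shows "\<theta> > 0" "(d\<^sup>2 - \<theta>\<^sup>2) / \<theta>\<^sup>2 * u + 1 / (2 * B ^ 4) \<le> w"
proof -
  have n: "n > 0" using card_verts_pos by (simp add: n_def)
  have d: "d > 0" using theta_nonneg theta_less by linarith
  have uw: "u + w > 0" using u_pos by (simp add: w_def)
  have "d\<^sup>2 \<le> B\<^sup>2" using d dB by (intro power_mono) auto
  then have "d\<^sup>2 - \<theta>\<^sup>2 \<le> B\<^sup>2" using zero_le_power2[of \<theta>] by linarith
  then have "(d\<^sup>2 - \<theta>\<^sup>2) * (d\<^sup>2 * u\<^sup>2) \<le> B\<^sup>2 * (B\<^sup>2 * k\<^sup>2)"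
    using d dB u_pos uk theta_sq_less by (intro mult_mono power_mono) auto
  also have "\<dots> \<le> n / 2" using nk by (simp add: power2_eq_square power4_eq_xxxx algebra_simps)
  finally have "(d\<^sup>2 - \<theta>\<^sup>2) * (d\<^sup>2 * u\<^sup>2) / n \<le> 1 / 2" using n by (simp add: field_simps)
  then have *: "1 / 2 \<le> \<theta>\<^sup>2 * (\<theta>\<^sup>2 * u - d\<^sup>2 * u\<^sup>2 / (u + w))"
    using second_neighborhood_gap[OF far] by linarith
  show \<theta>: "\<theta> > 0"
  proof (rule ccontr)
    assume "\<not> \<theta> > 0"
    then have "\<theta> = 0" using theta_nonneg by simp
    then show False using * by simp
  qed
  have "1 / 2 \<le> 1 / 2 * ((u + w) / u)" using u_pos by (simp add: w_def field_simps)
  also have "\<dots> \<le> \<theta>\<^sup>2 * (\<theta>\<^sup>2 * u - d\<^sup>2 * u\<^sup>2 / (u + w)) * ((u + w) / u)"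
    using * uw u_pos by (intro mult_right_mono) auto
  also have "(\<theta>\<^sup>2 * u - d\<^sup>2 * u\<^sup>2 / (u + w)) * ((u + w) / u) = \<theta>\<^sup>2 * w - (d\<^sup>2 - \<theta>\<^sup>2) * u"
  proof -
    have "(\<theta>\<^sup>2 * u - d\<^sup>2 * u\<^sup>2 / s) * (s / u) = \<theta>\<^sup>2 * s - d\<^sup>2 * u" if "s > 0" for s
      using that u_pos by (simp add: power2_eq_square field_simps)
    from this[OF uw] show ?thesis by (simp add: algebra_simps)
  qed
  then have "\<theta>\<^sup>2 * (\<theta>\<^sup>2 * u - d\<^sup>2 * u\<^sup>2 / (u + w)) * ((u + w) / u) = \<theta>\<^sup>2 * (\<theta>\<^sup>2 * w - (d\<^sup>2 - \<theta>\<^sup>2) * u)"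
    by (simp only: mult.assoc)
  finally have "1 / 2 \<le> \<theta>\<^sup>2 * (\<theta>\<^sup>2 * w - (d\<^sup>2 - \<theta>\<^sup>2) * u)" .
  then have "1 / (2 * \<theta> ^ 4) \<le> w - (d\<^sup>2 - \<theta>\<^sup>2) / \<theta>\<^sup>2 * u"
    using \<theta> by (simp add: field_simps power2_eq_square power4_eq_xxxx)
  moreover have "1 / (2 * B ^ 4) \<le> 1 / (2 * \<theta> ^ 4)"
    using \<theta> theta_less dB by (intro divide_left_mono mult_left_mono power_mono mult_pos_pos zero_less_power) auto
  ultimately show "(d\<^sup>2 - \<theta>\<^sup>2) / \<theta>\<^sup>2 * u + 1 / (2 * B ^ 4) \<le> w" by linarith
qed

end

end

text \<open>
  The extremal eigenfunction of \<open>d - L\<close> attains the norm on sum-zero functions, and \<open>theta\<close>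
  is at least the absolute value of its eigenvalue.
\<close>
lemma contracting_graphI:
  fixes G :: "('a :: linorder, 'b) pre_digraph"
  assumes G: "graph G" and card: "2 \<le> card (verts G)" and gap: "theta G < avg_degree G"
  shows "contracting_graph G (avg_degree G) (theta G)"
proof -
  interpret graph G by fact
  show ?thesis
  proof
    show "0 \<le> theta G" using theta_nonneg[OF card] .
    show "theta G < avg_degree G" by fact
    fix g assume g: "g \<in> zero_sum_functions (verts G)"
    let ?K = "shifted_kernel G (avg_degree G)"
    show "(\<Sum>v\<in>verts G. (kernel_operator (verts G) ?K g v)\<^sup>2) \<le> (theta G)\<^sup>2 * (\<Sum>v\<in>verts G. (g v)\<^sup>2)"
    proof (rule extremal_eigenfunction[OF finite_verts card shifted_kernel_sym[where d = "avg_degree G"]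
          shifted_kernel_row_sum[where d = "avg_degree G"]])
      fix f \<mu>
      assume f: "f \<in> zero_sum_functions (verts G)" "f \<noteq> (\<lambda>_. 0)"
          "kernel_operator (verts G) ?K f = (\<lambda>v. \<mu> * f v)"
        and bound: "\<And>g. g \<in> zero_sum_functions (verts G) \<Longrightarrow>
          (\<Sum>v\<in>verts G. (kernel_operator (verts G) ?K g v)\<^sup>2) \<le> \<mu>\<^sup>2 * (\<Sum>v\<in>verts G. (g v)\<^sup>2)"
      have "\<bar>\<mu>\<bar> \<le> theta G" by (rule abs_eigenvalue_le_theta[OF G card f])
      then have "\<mu>\<^sup>2 \<le> (theta G)\<^sup>2" using power_mono[of "\<bar>\<mu>\<bar>" "theta G" 2] by simp
      then have "\<mu>\<^sup>2 * (\<Sum>v\<in>verts G. (g v)\<^sup>2) \<le> (theta G)\<^sup>2 * (\<Sum>v\<in>verts G. (g v)\<^sup>2)"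
        by (intro mult_right_mono sum_nonneg) auto
      then show ?thesis using bound[OF g] by linarith
    qed
  qed
qed

section \<open>Connected sets and components\<close>

context graph begin

text \<open>
  Connectivity without paths: no proper nonempty part is cut off from the rest. Minimality arguments
  and inductions over splittings use it in this form.
\<close>
definition connected_set :: "'a set \<Rightarrow> bool" where
  "connected_set U \<longleftrightarrow> U \<noteq> {} \<and> (\<forall>A. A \<subset> U \<longrightarrow> A \<noteq> {} \<longrightarrow> (\<exists>a\<in>A. \<exists>b\<in>U - A. a \<rightarrow> b))"

lemma connected_setD:
  "connected_set U \<Longrightarrow> A \<subset> U \<Longrightarrow> A \<noteq> {} \<Longrightarrow> \<exists>a\<in>A. \<exists>b\<in>U - A. a \<rightarrow> b"
  by (auto simp: connected_set_def)

lemma neighborhood_subset: "neighborhood G U \<subseteq> verts G"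
  by (auto simp: neighborhood_def)

lemma finite_neighborhood [simp]: "finite (neighborhood G U)"
  by (rule finite_subset[OF neighborhood_subset finite_verts])

lemma in_neighborhoodI: "u \<in> U \<Longrightarrow> u \<rightarrow> v \<Longrightarrow> v \<notin> U \<Longrightarrow> v \<in> neighborhood G U"
  using graph_symmetric by (auto simp: neighborhood_def dest: adj_in_verts)

text \<open>
  Within \<open>R\<close>, a union of components contains every connected set that it meets.
\<close>
lemma connected_set_subset_closed:
  assumes "connected_set A" "A \<subseteq> R" "neighborhood G B \<inter> R = {}" "A \<inter> B \<noteq> {}"
  shows "A \<subseteq> B"
proof (rule ccontr)
  assume "\<not> A \<subseteq> B"
  then have "A \<inter> B \<subset> A" by blast
  then obtain a b where "a \<in> A \<inter> B" "b \<in> A - A \<inter> B" "a \<rightarrow> b"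
    using connected_setD assms by meson
  then have "b \<in> neighborhood G B \<inter> R" using assms(2) in_neighborhoodI[of a B b] by blast
  then show False using assms(3) by blast
qed

text \<open>
  Unions of components of \<open>G - D\<close> with at most half of the vertices have at most \<open>card D / c\<close>
  vertices, since all their neighbours lie in \<open>D\<close>. A smallest union of components with more than
  half of the vertices is therefore connected: if it split, it would consist of two parts of that
  kind, which together have at most \<open>2 card D / c \<le> n / 2\<close> vertices.
\<close>
lemma giant_connected_set:
  fixes c :: real
  assumes D: "D \<subseteq> verts G" and c: "c > 0"
    and expand: "\<And>U. U \<subseteq> verts G \<Longrightarrow> 2 * card U \<le> card (verts G) \<Longrightarrow> c * card U \<le> card (neighborhood G U)"
    and few: "2 * card D < card (verts G)" "4 * card D \<le> c * card (verts G)"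
  obtains A where "A \<subseteq> verts G - D" "connected_set A" "neighborhood G A \<inter> (verts G - D) = {}"
    "card (verts G) < 2 * card A" "c * card (verts G - D - A) \<le> card D"
proof -
  let ?V = "verts G" and ?R = "verts G - D"
  have fin: "finite X" if "X \<subseteq> ?V" for X using finite_subset[OF that] by simp
  define closed where "closed X \<longleftrightarrow> X \<subseteq> ?R \<and> neighborhood G X \<inter> ?R = {}" for X
  have closed_iff: "closed X \<longleftrightarrow> X \<subseteq> ?R \<and> (\<forall>u\<in>X. \<forall>v\<in>?R. u \<rightarrow> v \<longrightarrow> v \<in> X)" for X
    unfolding closed_def neighborhood_def using graph_symmetric by blast
  have small: "c * card X \<le> card D" if "closed X" "2 * card X \<le> card ?V" for X
  proof -
    have "neighborhood G X \<subseteq> D" using that(1) neighborhood_subset[of X] by (auto simp: closed_def)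
    then have "card (neighborhood G X) \<le> card D" using fin[OF D] by (intro card_mono)
    moreover have "c * card X \<le> card (neighborhood G X)"
      using that by (intro expand) (auto simp: closed_def)
    ultimately show ?thesis by linarith
  qed
  have "closed ?R" by (auto simp: closed_def neighborhood_def)
  moreover have "card ?V < 2 * card ?R"
    using few(1) D fin[OF D] by (simp add: card_Diff_subset)
  ultimately have "closed ?R \<and> card ?V < 2 * card ?R" by blast
  then obtain A where A: "closed A" "card ?V < 2 * card A"
    and least: "\<And>B. closed B \<and> card ?V < 2 * card B \<Longrightarrow> card A \<le> card B"
    using ex_has_least_nat[of "\<lambda>X. closed X \<and> card ?V < 2 * card X" ?R card] by blast
  have finA: "finite A" using A fin by (auto simp: closed_def)
  have part: "closed B \<and> closed (A - B)" if "B \<subseteq> A" "\<not> (\<exists>a\<in>B. \<exists>b\<in>A - B. a \<rightarrow> b)" for B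
    using that A(1) graph_symmetric unfolding closed_iff by blast
  have "connected_set A"
    unfolding connected_set_def
  proof (intro conjI allI impI)
    show "A \<noteq> {}" using A by auto
    fix B assume B: "B \<subset> A" "B \<noteq> {}"
    show "\<exists>a\<in>B. \<exists>b\<in>A - B. a \<rightarrow> b"
    proof (rule ccontr)
      assume no: "\<not> ?thesis"
      have cl: "closed B" "closed (A - B)" using part[OF _ no] B by auto
      have "card B < card A" using B finA by (intro psubset_card_mono)
      moreover have "card (A - B) < card A" using B finA by (intro psubset_card_mono) auto
      ultimately have "2 * card B \<le> card ?V" "2 * card (A - B) \<le> card ?V"
        using least[of B] least[of "A - B"] cl by (meson not_le)+
      then have "c * card B \<le> card D" "c * card (A - B) \<le> card D" using small cl by blast+
      moreover have "card A = card B + card (A - B)"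
        using B finA by (metis card_Diff_subset card_mono finite_subset le_add_diff_inverse psubset_imp_subset)
      ultimately have "c * card A \<le> 2 * card D" by (simp add: distrib_left)
      moreover have "c * card ?V < c * (2 * card A)" using A(2) c by (intro mult_strict_left_mono) (auto simp flip: of_nat_mult)
      ultimately show False using few(2) by simp
    qed
  qed
  moreover have "c * card (?R - A) \<le> card D"
  proof (rule small)
    show "closed (?R - A)" using A(1) graph_symmetric unfolding closed_iff by blast
    have "card (?R - A) \<le> card (?V - A)" by (intro card_mono) auto
    also have "\<dots> = card ?V - card A" using A fin by (intro card_Diff_subset) (auto simp: closed_def)
    finally show "2 * card (?R - A) \<le> card ?V" using A(2) by linarith
  qed
  ultimately show thesis using A that unfolding closed_def by blast
qed

text \<open>
  The number of edges leaving \<open>U\<close> is additive when \<open>U\<close> splits into parts without edges between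
  them, unlike the number of neighbours. So the bound is proved for edges by induction over
  splittings, and translated back to vertices at the cost of the factor \<open>B\<close>.
\<close>
lemma expansion_from_connected_sets:
  fixes \<gamma> :: real
  assumes C: "C \<subseteq> verts G" and deg: "\<And>v. v \<in> verts G \<Longrightarrow> out_degree G v \<le> B"
    and conn: "\<And>U. U \<subseteq> C \<Longrightarrow> connected_set U \<Longrightarrow> 2 * card U \<le> card C \<Longrightarrow>
      \<gamma> * card U \<le> card (neighborhood G U \<inter> C)"
    and U: "U \<subseteq> C" "2 * card U \<le> card C"
  shows "\<gamma> * card U \<le> B * card (neighborhood G U \<inter> C)"
proof -
  define cut where "cut U = {(u, v). u \<in> U \<and> v \<in> C - U \<and> u \<rightarrow> v}" for U
  have finC: "finite C" using C finite_subset finite_verts by blast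
  have fin_cut: "finite (cut U)" if "U \<subseteq> C" for U
    using finite_subset[of "cut U" "C \<times> C"] that finC by (auto simp: cut_def)
  have "\<gamma> * card U \<le> card (cut U)" using U
  proof (induction "card U" arbitrary: U rule: less_induct)
    case less
    note U = less.prems
    have finU: "finite U" using U finC finite_subset by blast
    consider "U = {}" | "connected_set U" | A where "A \<subset> U" "A \<noteq> {}" "\<not> (\<exists>a\<in>A. \<exists>b\<in>U - A. a \<rightarrow> b)"
      unfolding connected_set_def by blast
    then show ?case
    proof cases
      case 2
      have "neighborhood G U \<inter> C \<subseteq> snd ` cut U"
        using graph_symmetric by (fastforce simp: neighborhood_def cut_def image_iff)
      then have "card (neighborhood G U \<inter> C) \<le> card (cut U)"
        using surj_card_le[OF fin_cut[OF U(1)]] by blast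
      then show ?thesis using conn[OF U(1) 2 U(2)] by linarith
    next
      case A: 3
      have lt: "card A < card U" "card (U - A) < card U" using A finU by (auto intro!: psubset_card_mono)
      have sub: "A \<subseteq> C" "U - A \<subseteq> C" using A U by auto
      have card: "card U = card A + card (U - A)"
        using A finU by (metis card_Diff_subset card_mono finite_subset le_add_diff_inverse psubset_imp_subset)
      have "cut U = cut A \<union> cut (U - A)" "cut A \<inter> cut (U - A) = {}"
        using A U graph_symmetric unfolding cut_def by blast+
      then have "card (cut U) = card (cut A) + card (cut (U - A))"
        using fin_cut sub by (simp add: card_Un_disjoint)
      then show ?thesis
        using less.hyps[OF lt(1) sub(1)] less.hyps[OF lt(2) sub(2)] lt U(2)
        by (simp add: card distrib_left)
    qed simp
  qed
  also have "card (cut U) \<le> B * card (neighborhood G U \<inter> C)"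
  proof -
    have "cut U \<subseteq> (\<Union>v\<in>neighborhood G U \<inter> C. (\<lambda>u. (u, v)) ` {u \<in> verts G. v \<rightarrow> u})"
    proof
      fix e assume "e \<in> cut U"
      then obtain u v where e: "e = (u, v)" "u \<in> U" "v \<in> C - U" "u \<rightarrow> v" by (auto simp: cut_def)
      then have "v \<in> neighborhood G U \<inter> C" "u \<in> {u \<in> verts G. v \<rightarrow> u}"
        using in_neighborhoodI graph_symmetric adj_in_verts by blast+
      then show "e \<in> (\<Union>v\<in>neighborhood G U \<inter> C. (\<lambda>u. (u, v)) ` {u \<in> verts G. v \<rightarrow> u})"
        unfolding e(1) by blast
    qed
    then have "card (cut U) \<le> card (\<Union>v\<in>neighborhood G U \<inter> C. (\<lambda>u. (u, v)) ` {u \<in> verts G. v \<rightarrow> u})"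
      by (intro card_mono) auto
    also have "\<dots> \<le> (\<Sum>v\<in>neighborhood G U \<inter> C. card ((\<lambda>u. (u, v)) ` {u \<in> verts G. v \<rightarrow> u}))"
      by (intro card_UN_le) auto
    also have "\<dots> \<le> (\<Sum>v\<in>neighborhood G U \<inter> C. B)"
      using deg C by (intro sum_mono order_trans[OF card_image_le]) (auto simp: out_degree_eq_card)
    finally show ?thesis by (simp add: mult.commute)
  qed
  then have "real (card (cut U)) \<le> B * card (neighborhood G U \<inter> C)" by (simp flip: of_nat_mult)
  finally show ?thesis .
qed

lemma wf_induce: "wf_digraph (G \<restriction> A)" by (rule wellformed_induce_subgraph)

lemma arcs_ends_induce: "u \<rightarrow>\<^bsub>G \<restriction> A\<^esub> v \<longleftrightarrow> u \<in> A \<and> v \<in> A \<and> u \<rightarrow> v"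
  by (auto simp: arcs_ends_conv image_iff)

lemma connected_crossing_arc:
  assumes H: "subgraph H G" "Digraph_Component.connected H" and A: "A \<subset> verts H" "A \<noteq> {}"
  shows "\<exists>a\<in>A. \<exists>b\<in>verts H - A. a \<rightarrow> b"
proof -
  obtain a b where ab: "a \<in> A" "b \<in> verts H" "b \<notin> A" using A by blast
  interpret H: wf_digraph H using H by auto
  have "(a, b) \<in> rtrancl_on (verts H) ((arcs_ends H)\<^sup>s)"
    using H(2) ab A unfolding connected_conv by blast
  then have "(a, b) \<in> ((arcs_ends H)\<^sup>s)\<^sup>*" by (rule rtrancl_on_rtranclI)
  then have "b \<in> A \<or> (\<exists>x\<in>A. \<exists>y. y \<notin> A \<and> (x, y) \<in> (arcs_ends H)\<^sup>s)"
    using ab(1) by induction blast+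
  then obtain x y where "x \<in> A" "y \<notin> A" "x \<rightarrow>\<^bsub>H\<^esub> y \<or> y \<rightarrow>\<^bsub>H\<^esub> x"
    using ab by (auto simp: symcl_def)
  moreover then have "y \<in> verts H" "x \<rightarrow> y"
    using arcs_ends_mono[OF H(1)] H.adj_in_verts adj_sym by blast+
  ultimately show ?thesis by blast
qed

lemma connected_induce_iff:
  assumes "A \<subseteq> verts G"
  shows "Digraph_Component.connected (G \<restriction> A) \<longleftrightarrow> connected_set A"
proof
  assume c: "Digraph_Component.connected (G \<restriction> A)"
  then have "A \<noteq> {}" by (simp add: connected_conv)
  moreover have "\<exists>a\<in>X. \<exists>b\<in>A - X. a \<rightarrow> b" if "X \<subset> A" "X \<noteq> {}" for X
    using connected_crossing_arc[OF subgraph_induce_subgraphI[OF assms] c, of X] that by simp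
  ultimately show "connected_set A" by (simp add: connected_set_def)
next
  assume A: "connected_set A"
  let ?r = "rtrancl_on A ((arcs_ends (G \<restriction> A))\<^sup>s)"
  have "(u, v) \<in> ?r" if "u \<in> A" "v \<in> A" for u v
  proof -
    have "{v \<in> A. (u, v) \<in> ?r} = A"
    proof (rule ccontr)
      assume "{v \<in> A. (u, v) \<in> ?r} \<noteq> A"
      then have "{v \<in> A. (u, v) \<in> ?r} \<subset> A" by blast
      moreover have "u \<in> {v \<in> A. (u, v) \<in> ?r}" using that by auto
      ultimately obtain a b where ab: "a \<in> A" "(u, a) \<in> ?r" "b \<in> A" "(u, b) \<notin> ?r" "a \<rightarrow> b"
        using connected_setD[OF A, of "{v \<in> A. (u, v) \<in> ?r}"] by blast
      then have "(a, b) \<in> (arcs_ends (G \<restriction> A))\<^sup>s" by (simp add: symcl_def arcs_ends_induce)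
      from rtrancl_on_into_rtrancl_on[OF ab(2) this ab(3)] show False using ab by blast
    qed
    then show ?thesis using that by blast
  qed
  then show "Digraph_Component.connected (G \<restriction> A)"
    using A by (simp add: connected_conv connected_set_def)
qed

lemma connected_set_insert:
  assumes A: "connected_set A" and v: "v \<in> neighborhood G A"
  shows "connected_set (insert v A)"
  unfolding connected_set_def
proof (intro conjI allI impI)
  fix B assume B: "B \<subset> insert v A" "B \<noteq> {}"
  obtain u where u: "u \<in> A" "u \<rightarrow> v" "v \<rightarrow> u" "v \<notin> A" using v graph_symmetric by (auto simp: neighborhood_def)
  show "\<exists>a\<in>B. \<exists>b\<in>insert v A - B. a \<rightarrow> b"
  proof (cases "B \<inter> A = {} \<or> A \<subseteq> B")
    case True
    then show ?thesis using B u by blast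
  next
    case False
    then have "B \<inter> A \<subset> A" "B \<inter> A \<noteq> {}" by auto
    then show ?thesis using connected_setD[OF A] by blast
  qed
qed simp

text \<open>
  A connected subgraph can be enlarged by any vertex of \<open>R\<close> that is adjacent to it, and no
  connected subgraph of \<open>G \<restriction> R\<close> leaves a set that has no neighbours in \<open>R\<close>.
\<close>
lemma components_induce:
  assumes R: "R \<subseteq> verts G"
  shows "components (G \<restriction> R) = {G \<restriction> A |A. A \<subseteq> R \<and> connected_set A \<and> neighborhood G A \<inter> R = {}}"
proof (intro equalityI subsetI)
  fix C assume "C \<in> components (G \<restriction> R)"
  then have C: "pre_digraph.max_subgraph (G \<restriction> R) Digraph_Component.connected C" by (simp add: components_def)
  interpret R: wf_digraph "G \<restriction> R" by (rule wf_induce)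
  have sub: "subgraph C (G \<restriction> R)" and conn: "Digraph_Component.connected C"
    and max: "\<And>H. H \<noteq> C \<Longrightarrow> subgraph C H \<Longrightarrow> subgraph H (G \<restriction> R) \<Longrightarrow> \<not> Digraph_Component.connected H"
    using C unfolding R.max_subgraph_def by auto
  let ?A = "verts C"
  have AR: "?A \<subseteq> R" using subgraph_imp_subverts[OF sub] by simp
  have "arc_mono (Digraph_Component.connected :: ('a, 'b) pre_digraph \<Rightarrow> bool)"
    unfolding arc_mono_def
  proof (intro allI impI, elim conjE)
    fix H1 H2 :: "('a, 'b) pre_digraph"
    assume "Digraph_Component.connected H1" "subgraph H1 H2" "verts H1 = verts H2"
    then show "Digraph_Component.connected H2"
      using wf_digraph.connected_spanning_imp_connected[of H2 H1] by (auto simp: spanning_def)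
  qed
  then have "induced_subgraph C (G \<restriction> R)" using R.induced_subgraphI_arc_mono C by blast
  then have "C = (G \<restriction> R) \<restriction> ?A" using R.induce_eq_iff_induced by simp
  also have "\<dots> = G \<restriction> ?A" using AR by (auto simp: induce_subgraph_def)
  finally have CA: "C = G \<restriction> ?A" .
  then have cA: "connected_set ?A" using conn AR R connected_induce_iff[of ?A] by simp
  moreover have "neighborhood G ?A \<inter> R = {}"
  proof (rule ccontr)
    assume "neighborhood G ?A \<inter> R \<noteq> {}"
    then obtain v where v: "v \<in> neighborhood G ?A" "v \<in> R" by blast
    let ?H = "G \<restriction> insert v ?A"
    have vA: "v \<notin> ?A" using v by (simp add: neighborhood_def)
    have "verts ?H \<noteq> ?A" using vA by auto
    then have "?H \<noteq> C" by metis
    moreover have "subgraph (G \<restriction> ?A) ?H"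
      by (rule subgraphI) (auto intro: wf_induce simp: compatible_def)
    then have "subgraph C ?H" by (simp only: CA[symmetric])
    moreover have "subgraph ?H (G \<restriction> R)"
      using v AR by (intro subgraphI) (auto intro: wf_induce simp: compatible_def)
    moreover have "Digraph_Component.connected ?H"
      using connected_set_insert[OF cA v(1)] v AR R by (subst connected_induce_iff) auto
    ultimately show False using max by blast
  qed
  ultimately show "C \<in> {G \<restriction> A |A. A \<subseteq> R \<and> connected_set A \<and> neighborhood G A \<inter> R = {}}"
    using CA AR by blast
next
  fix C assume "C \<in> {G \<restriction> A |A. A \<subseteq> R \<and> connected_set A \<and> neighborhood G A \<inter> R = {}}"
  then obtain A where C: "C = G \<restriction> A" and A: "A \<subseteq> R" "connected_set A" "neighborhood G A \<inter> R = {}" by blast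
  have "subgraph (G \<restriction> A) (G \<restriction> R)"
    using A by (intro subgraphI) (auto intro: wf_induce simp: compatible_def)
  moreover have "Digraph_Component.connected (G \<restriction> A)" using A R connected_induce_iff[of A] by auto
  moreover have "\<not> Digraph_Component.connected H"
    if H: "H \<noteq> G \<restriction> A" "subgraph (G \<restriction> A) H" "subgraph H (G \<restriction> R)" for H
  proof
    assume conn: "Digraph_Component.connected H"
    have HG: "subgraph H G" using H(3) subgraph_induce_subgraphI[OF R] subgraph_trans by blast
    interpret H: wf_digraph H using HG by auto
    have AH: "A \<subseteq> verts H" "verts H \<subseteq> R"
      using H(2,3)[THEN subgraph_imp_subverts] by simp_all
    show False
    proof (cases "verts H = A")
      case True
      have "arcs H \<subseteq> arcs (G \<restriction> A)"
        using HG H.tail_in_verts H.head_in_verts True by (auto simp: subgraph_def compatible_def)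
      then have "H = G \<restriction> A" using True H(2) by (auto simp: subgraph_def compatible_def)
      then show False using H(1) by blast
    next
      case False
      then obtain a b where "a \<in> A" "b \<in> verts H - A" "a \<rightarrow> b"
        using connected_crossing_arc[OF HG conn, of A] AH A(2) unfolding connected_set_def by blast
      then have "b \<in> neighborhood G A \<inter> R" using AH in_neighborhoodI by blast
      then show False using A(3) by blast
    qed
  qed
  ultimately show "C \<in> components (G \<restriction> R)"
    unfolding components_def pre_digraph.max_subgraph_def C by blast
qed

lemma neighborhood_induce:
  assumes "A \<subseteq> verts G" "U \<subseteq> A" shows "neighborhood (G \<restriction> A) U = neighborhood G U \<inter> A"
  using assms by (auto simp: neighborhood_def arcs_ends_induce)

end

section \<open>Deleting few vertices\<close>

context graph begin

text \<open>
  Inside the giant component, a connected set with at most \<open>K\<close> vertices has at least one neighbour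
  because the giant is connected, and a larger one keeps half of its guaranteed neighbours; this
  gives expansion. Another component has all its neighbours in \<open>D\<close>, so it has at most \<open>K\<close> vertices,
  and then at most \<open>s\<close>.
\<close>
lemma deletion_leaves_expander:
  fixes c s :: real
  assumes D: "D \<subseteq> verts G" and c: "c > 0" and K: "K \<ge> 1" and B: "B \<ge> 1"
    and expand: "\<And>U. U \<subseteq> verts G \<Longrightarrow> 2 * card U \<le> card (verts G) \<Longrightarrow> c * card U \<le> card (neighborhood G U)"
    and deg: "\<And>v. v \<in> verts G \<Longrightarrow> out_degree G v \<le> B"
    and few: "2 * card D < card (verts G)" "4 * card D \<le> c * card (verts G)"
    and large: "\<And>U. U \<subseteq> verts G \<Longrightarrow> connected_set U \<Longrightarrow> K < card U \<Longrightarrow> 2 * card U \<le> card (verts G) \<Longrightarrow>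
      card (neighborhood G U \<inter> D) < c / 2 * card U"
    and small: "\<And>U. U \<subseteq> verts G \<Longrightarrow> connected_set U \<Longrightarrow> card U \<le> K \<Longrightarrow> neighborhood G U \<subseteq> D \<Longrightarrow> card U \<le> s"
  shows "\<exists>C\<in>components (G \<restriction> (verts G - D)).
    card (verts G) - (1 + 1 / c) * card D \<le> card (verts C) \<and> expander (min (1 / K) (c / 2) / B) C \<and>
    (\<forall>C'\<in>components (G \<restriction> (verts G - D)). C' \<noteq> C \<longrightarrow> card (verts C') \<le> s)"
proof -
  let ?R = "verts G - D"
  obtain A where A: "A \<subseteq> ?R" "connected_set A" "neighborhood G A \<inter> ?R = {}"
    and half: "card (verts G) < 2 * card A" and rest: "c * card (?R - A) \<le> card D"
    using giant_connected_set[OF D c expand few] by blast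
  have AV: "A \<subseteq> verts G" using A by blast
  have finA: "finite A" using finite_subset[OF AV] by simp
  have finD: "finite D" using finite_subset[OF D] by simp
  have comps: "components (G \<restriction> ?R) = {G \<restriction> A |A. A \<subseteq> ?R \<and> connected_set A \<and> neighborhood G A \<inter> ?R = {}}"
    by (rule components_induce) blast
  have "card (verts G) - (1 + 1 / c) * card D \<le> card A"
  proof -
    have "card (verts G) = card D + card (?R - A) + card A"
    proof -
      have "card ?R = card (?R - A) + card A"
        using A finA by (metis card_Diff_subset card_mono finite_Diff finite_verts le_add_diff_inverse2)
      moreover have "card (verts G) = card D + card ?R"
        using D finD by (metis card_Diff_subset card_mono finite_verts le_add_diff_inverse)
      ultimately show ?thesis by simp
    qed
    moreover have "card (?R - A) \<le> card D / c" using rest c by (simp add: field_simps)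
    ultimately show ?thesis by (simp add: algebra_simps)
  qed
  moreover have "expander (min (1 / K) (c / 2) / B) (G \<restriction> A)"
    unfolding expander_def
  proof (intro allI impI)
    fix U assume "U \<subseteq> verts (G \<restriction> A)" "real (card U) \<le> real (card (verts (G \<restriction> A))) / 2"
    then have U: "U \<subseteq> A" "2 * card U \<le> card A" by simp_all
    have "min (1 / K) (c / 2) * card U \<le> B * card (neighborhood G U \<inter> A)"
    proof (rule expansion_from_connected_sets[OF AV deg _ U])
      fix U assume U: "U \<subseteq> A" "connected_set U" "2 * card U \<le> card A"
      have finU: "finite U" using finite_subset[OF U(1) finA] .
      have Upos: "card U > 0" using U(2) finU by (simp add: card_gt_0_iff connected_set_def)
      show "min (1 / K) (c / 2) * card U \<le> card (neighborhood G U \<inter> A)"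
      proof (cases "card U \<le> K")
        case True
        have "U \<subset> A" "U \<noteq> {}" using U Upos by auto
        then obtain a b where ab: "a \<in> U" "b \<in> A - U" "a \<rightarrow> b"
          using connected_setD[OF A(2)] by blast
        then have "b \<in> neighborhood G U \<inter> A" using in_neighborhoodI by blast
        then have "card (neighborhood G U \<inter> A) \<noteq> 0" by auto
        then have "1 \<le> card (neighborhood G U \<inter> A)" by linarith
        moreover have "min (1 / K) (c / 2) * card U \<le> 1 / K * card U" by (intro mult_right_mono) auto
        moreover have "1 / K * card U \<le> 1" using True K by simp
        ultimately show ?thesis by linarith
      next
        case False
        have UV: "U \<subseteq> verts G" using U AV by blast
        have cU: "2 * card U \<le> card (verts G)"
          using U(3) card_mono[OF finite_verts AV] by linarith
        have "neighborhood G U - A \<subseteq> neighborhood G A" using U(1) by (auto simp: neighborhood_def)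
        then have "neighborhood G U \<subseteq> (neighborhood G U \<inter> A) \<union> (neighborhood G U \<inter> D)"
          using A(3) neighborhood_subset[of U] by blast
        then have "card (neighborhood G U) \<le> card ((neighborhood G U \<inter> A) \<union> (neighborhood G U \<inter> D))"
          by (intro card_mono) auto
        also have "\<dots> \<le> card (neighborhood G U \<inter> A) + card (neighborhood G U \<inter> D)" by (rule card_Un_le)
        finally have "card (neighborhood G U) \<le> card (neighborhood G U \<inter> A) + card (neighborhood G U \<inter> D)" .
        moreover have "c * card U \<le> card (neighborhood G U)" using expand[OF UV cU] .
        moreover have "card (neighborhood G U \<inter> D) < c / 2 * card U" using large UV U(2) False cU by simp
        moreover have "c * card U = c / 2 * card U + c / 2 * card U" by simp
        ultimately have "c / 2 * card U \<le> card (neighborhood G U \<inter> A)" by linarith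
        moreover have "min (1 / K) (c / 2) * card U \<le> c / 2 * card U" by (intro mult_right_mono) auto
        ultimately show ?thesis by linarith
      qed
    qed auto
    then show "min (1 / K) (c / 2) / B * card U \<le> card (neighborhood (G \<restriction> A) U)"
      using B by (simp add: neighborhood_induce[OF AV U(1)] field_simps)
  qed
  moreover have "card (verts C') \<le> s" if C': "C' \<in> components (G \<restriction> ?R)" "C' \<noteq> G \<restriction> A" for C'
  proof -
    obtain A' where A': "C' = G \<restriction> A'" "A' \<subseteq> ?R" "connected_set A'" "neighborhood G A' \<inter> ?R = {}"
      using C'(1) unfolding comps by blast
    have "A \<inter> A' = {}"
    proof (rule ccontr)
      assume "A \<inter> A' \<noteq> {}"
      then have "A \<subseteq> A'" "A' \<subseteq> A"
        using connected_set_subset_closed[of A ?R A'] connected_set_subset_closed[of A' ?R A] A A' by blast+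
      then show False using C'(2) A'(1) by simp
    qed
    then have "card (A \<union> A') = card A + card A'"
      using finA A'(2) finite_subset[of A' "verts G"] by (intro card_Un_disjoint) auto
    moreover have "card (A \<union> A') \<le> card (verts G)" using A A' by (intro card_mono) auto
    ultimately have cA': "2 * card A' \<le> card (verts G)" using half by linarith
    have A'V: "A' \<subseteq> verts G" using A'(2) by blast
    have ND: "neighborhood G A' \<subseteq> D" using A'(4) neighborhood_subset[of A'] by blast
    then have "neighborhood G A' \<inter> D = neighborhood G A'" by blast
    then have "\<not> K < card A'"
      using large[OF A'V A'(3) _ cA'] expand[OF A'V cA'] c by (auto simp: field_simps)
    then show ?thesis using small[OF A'V A'(3) _ ND] A'(1) by simp
  qed
  ultimately show ?thesis using A unfolding comps by (intro bexI[of _ "G \<restriction> A"]) auto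
qed

end

section \<open>Counting connected sets\<close>

context graph begin

text \<open>
  The parameter counts the steps, so the list has one more entry.
\<close>
definition walks :: "nat \<Rightarrow> 'a list set" where
  "walks m = {xs. length xs = Suc m \<and> set xs \<subseteq> verts G \<and> successively (\<lambda>a b. a \<rightarrow> b) xs}"

lemma card_walks:
  assumes deg: "\<And>v. v \<in> verts G \<Longrightarrow> out_degree G v \<le> B"
  shows "finite (walks m) \<and> card (walks m) \<le> card (verts G) * B ^ m"
proof (induction m)
  case 0
  have "walks 0 = (\<lambda>v. [v]) ` verts G"
    by (auto simp: walks_def length_Suc_conv)
  then show ?case by (simp add: card_image inj_on_def)
next
  case (Suc m)
  have sub: "walks (Suc m) \<subseteq> (\<Union>xs\<in>walks m. (\<lambda>v. v # xs) ` {v \<in> verts G. hd xs \<rightarrow> v})"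
  proof
    fix ys assume "ys \<in> walks (Suc m)"
    then obtain v xs where ys: "ys = v # xs" "xs \<noteq> []" "length xs = Suc m" "v \<in> verts G" "set xs \<subseteq> verts G"
        "successively (\<lambda>a b. a \<rightarrow> b) (v # xs)"
      by (auto simp: walks_def length_Suc_conv)
    then have xs: "xs \<in> walks m" "v \<rightarrow> hd xs" by (auto simp: walks_def successively_Cons)
    then have "v \<in> {v \<in> verts G. hd xs \<rightarrow> v}" using ys(4) graph_symmetric by blast
    then show "ys \<in> (\<Union>xs\<in>walks m. (\<lambda>v. v # xs) ` {v \<in> verts G. hd xs \<rightarrow> v})"
      using xs(1) unfolding ys(1) by blast
  qed
  have "card (walks (Suc m)) \<le> card (\<Union>xs\<in>walks m. (\<lambda>v. v # xs) ` {v \<in> verts G. hd xs \<rightarrow> v})"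
    using Suc by (intro card_mono[OF _ sub]) auto
  also have "\<dots> \<le> (\<Sum>xs\<in>walks m. card ((\<lambda>v. v # xs) ` {v \<in> verts G. hd xs \<rightarrow> v}))"
    using Suc by (intro card_UN_le) auto
  also have "\<dots> \<le> (\<Sum>xs\<in>walks m. B)"
  proof (rule sum_mono)
    fix xs assume "xs \<in> walks m"
    then have "hd xs \<in> verts G" by (cases xs) (auto simp: walks_def)
    then have "card {v \<in> verts G. hd xs \<rightarrow> v} \<le> B" using deg by (simp add: out_degree_eq_card)
    then show "card ((\<lambda>v. v # xs) ` {v \<in> verts G. hd xs \<rightarrow> v}) \<le> B"
      using card_image_le[of "{v \<in> verts G. hd xs \<rightarrow> v}" "\<lambda>v. v # xs"] by simp
  qed
  also have "\<dots> \<le> card (verts G) * B ^ Suc m" using Suc by (simp add: mult.assoc mult.left_commute)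
  finally show ?case using finite_subset[OF sub] Suc by auto
qed

text \<open>
  A walk that has not yet covered \<open>U\<close> visits a vertex \<open>a\<close> with a neighbour \<open>b\<close> in the rest of \<open>U\<close>;
  the detour \<open>a, b, a\<close> adds two steps and one vertex.
\<close>
lemma connected_set_covering_walk:
  assumes U: "connected_set U" "finite U" and k: "k < card U"
  shows "\<exists>xs. length xs = Suc (2 * k) \<and> set xs \<subseteq> U \<and> card (set xs) = Suc k \<and> successively (\<lambda>a b. a \<rightarrow> b) xs"
  using k
proof (induction k)
  case 0
  obtain a where "a \<in> U" using U by (auto simp: connected_set_def)
  then show ?case by (intro exI[of _ "[a]"]) auto
next
  case (Suc k)
  then obtain xs where xs: "length xs = Suc (2 * k)" "set xs \<subseteq> U" "card (set xs) = Suc k"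
    "successively (\<lambda>a b. a \<rightarrow> b) xs" by auto
  have "set xs \<noteq> U" using xs(3) Suc.prems by auto
  then have "set xs \<subset> U" "set xs \<noteq> {}" using xs by auto
  then obtain a b where ab: "a \<in> set xs" "b \<in> U - set xs" "a \<rightarrow> b" using connected_setD[OF U(1)] by blast
  then obtain ys zs where xs_eq: "xs = ys @ a # zs" by (meson split_list)
  let ?xs = "ys @ a # b # a # zs"
  have "b \<rightarrow> a" using ab graph_symmetric by blast
  then have "successively (\<lambda>a b. a \<rightarrow> b) ?xs"
    using xs(4) ab(3) by (auto simp: xs_eq successively_append_iff)
  moreover have "set ?xs = insert b (set xs)" by (auto simp: xs_eq)
  then have "set ?xs \<subseteq> U" "card (set ?xs) = Suc (Suc k)" using xs ab by auto
  moreover have "length ?xs = Suc (2 * Suc k)" using xs(1) by (simp add: xs_eq)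
  ultimately show ?case by blast
qed

lemma card_connected_sets_le:
  assumes deg: "\<And>v. v \<in> verts G \<Longrightarrow> out_degree G v \<le> B" and B: "1 \<le> B"
  shows "card {U. U \<subseteq> verts G \<and> connected_set U \<and> card U = u} \<le> card (verts G) * B ^ (2 * u)"
proof (cases u)
  case 0
  have "U = {}" if "U \<subseteq> verts G" "card U = 0" for U
    using that finite_subset[OF that(1)] by simp
  then have "{U. U \<subseteq> verts G \<and> connected_set U \<and> card U = u} = {}"
    using 0 by (auto simp: connected_set_def)
  then show ?thesis by (simp only: card.empty le0)
next
  case (Suc k)
  have "{U. U \<subseteq> verts G \<and> connected_set U \<and> card U = u} \<subseteq> set ` walks (2 * k)"
  proof
    fix U assume "U \<in> {U. U \<subseteq> verts G \<and> connected_set U \<and> card U = u}"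
    then have U: "U \<subseteq> verts G" "connected_set U" "card U = Suc k" using Suc by auto
    have finU: "finite U" using finite_subset[OF U(1)] by simp
    obtain xs where xs: "length xs = Suc (2 * k)" "set xs \<subseteq> U" "card (set xs) = Suc k"
      "successively (\<lambda>a b. a \<rightarrow> b) xs"
      using connected_set_covering_walk[OF U(2) finU, of k] U(3) by auto
    then have "set xs = U" using card_subset_eq[OF finU] U(3) by simp
    then show "U \<in> set ` walks (2 * k)" using xs U(1) by (auto simp: walks_def)
  qed
  then have "card {U. U \<subseteq> verts G \<and> connected_set U \<and> card U = u} \<le> card (walks (2 * k))"
    using card_walks[OF deg] surj_card_le by blast
  also have "\<dots> \<le> card (verts G) * B ^ (2 * k)" using card_walks[OF deg] by blast
  also have "\<dots> \<le> card (verts G) * B ^ (2 * u)"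
    using B Suc by (intro mult_left_mono power_increasing) auto
  finally show ?thesis .
qed

lemma card_neighborhood_le:
  assumes deg: "\<And>v. v \<in> verts G \<Longrightarrow> out_degree G v \<le> B" and U: "U \<subseteq> verts G"
  shows "card (neighborhood G U) \<le> B * card U"
proof -
  have fin: "finite U" using finite_subset[OF U] by simp
  have "neighborhood G U \<subseteq> (\<Union>u\<in>U. {v \<in> verts G. u \<rightarrow> v})"
    using graph_symmetric unfolding neighborhood_def by blast
  then have "card (neighborhood G U) \<le> card (\<Union>u\<in>U. {v \<in> verts G. u \<rightarrow> v})"
    using fin by (intro card_mono) auto
  also have "\<dots> \<le> (\<Sum>u\<in>U. card {v \<in> verts G. u \<rightarrow> v})" using fin by (rule card_UN_le)
  also have "\<dots> \<le> (\<Sum>u\<in>U. B)" using deg U by (intro sum_mono) (auto simp: out_degree_eq_card)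
  finally show ?thesis by (simp add: mult.commute)
qed

end

section \<open>Probabilities of deletion\<close>

context graph begin

definition deleted :: "('a \<Rightarrow> bool) \<Rightarrow> 'a set" where
  "deleted f = {v \<in> verts G. f v}"

definition deletion_pmf :: "real \<Rightarrow> ('a \<Rightarrow> bool) pmf" where
  "deletion_pmf p = Pi_pmf (verts G) False (\<lambda>_. bernoulli_pmf p)"

lemma deleted_subset: "deleted f \<subseteq> verts G" by (auto simp: deleted_def)

lemma prob_all_deleted:
  fixes p :: real
  assumes p: "0 \<le> p" "p \<le> 1" and S: "S \<subseteq> verts G"
  shows "measure_pmf.prob (deletion_pmf p) {f. S \<subseteq> deleted f} = p ^ card S"
proof -
  have "{f. S \<subseteq> deleted f} = Pi (verts G) (\<lambda>v. if v \<in> S then {True} else UNIV)"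
    using S by (auto simp: deleted_def Pi_def split: if_splits)
  then have "measure_pmf.prob (deletion_pmf p) {f. S \<subseteq> deleted f} =
      (\<Prod>v\<in>verts G. measure_pmf.prob (bernoulli_pmf p) (if v \<in> S then {True} else UNIV))"
    by (simp add: deletion_pmf_def measure_Pi_pmf_Pi)
  also have "\<dots> = (\<Prod>v\<in>verts G. if v \<in> S then p else 1)"
    using p by (intro prod.cong) (auto simp: measure_pmf_single)
  also have "\<dots> = p ^ card S"
    using S by (simp add: prod.If_cases Int_absorb1)
  finally show ?thesis .
qed

lemma prob_some_deleted:
  fixes p a :: real
  assumes p: "0 < p" "p \<le> 1" and fin: "finite \<S>"
    and S: "\<And>S. S \<in> \<S> \<Longrightarrow> S \<subseteq> verts G" "\<And>S. S \<in> \<S> \<Longrightarrow> a \<le> real (card S)"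
  shows "measure_pmf.prob (deletion_pmf p) {f. \<exists>S\<in>\<S>. S \<subseteq> deleted f} \<le> card \<S> * p powr a"
proof -
  have "{f. \<exists>S\<in>\<S>. S \<subseteq> deleted f} = (\<Union>S\<in>\<S>. {f. S \<subseteq> deleted f})" by blast
  then have "measure_pmf.prob (deletion_pmf p) {f. \<exists>S\<in>\<S>. S \<subseteq> deleted f} \<le>
      (\<Sum>S\<in>\<S>. measure_pmf.prob (deletion_pmf p) {f. S \<subseteq> deleted f})"
    using fin by (simp add: measure_UNION_le)
  also have "\<dots> \<le> (\<Sum>S\<in>\<S>. p powr a)"
  proof (rule sum_mono)
    fix S assume "S \<in> \<S>"
    then have "measure_pmf.prob (deletion_pmf p) {f. S \<subseteq> deleted f} = p powr card S"
      using p S by (simp add: prob_all_deleted powr_realpow)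
    also have "\<dots> \<le> p powr a" using p S(2)[OF \<open>S \<in> \<S>\<close>] by (intro powr_mono') auto
    finally show "measure_pmf.prob (deletion_pmf p) {f. S \<subseteq> deleted f} \<le> p powr a" .
  qed
  finally show ?thesis by simp
qed

lemma prob_many_deleted:
  fixes p a :: real
  assumes p: "0 \<le> p" "p \<le> 1" and a: "a > 0"
  shows "measure_pmf.prob (deletion_pmf p) {f. a \<le> card (deleted f)} \<le> card (verts G) * p / a"
proof -
  let ?M = "measure_pmf (deletion_pmf p)"
  define X :: "('a \<Rightarrow> bool) \<Rightarrow> real" where "X f = (\<Sum>v\<in>verts G. indicator {f. {v} \<subseteq> deleted f} f)" for f
  have X: "X f = card (deleted f)" for f
  proof -
    have "X f = (\<Sum>v\<in>verts G. if f v then 1 else 0)"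
      unfolding X_def by (intro sum.cong) (auto simp: deleted_def)
    also have "\<dots> = real (card (deleted f))"
      by (simp add: sum.If_cases deleted_def Int_def)
    finally show ?thesis .
  qed
  have int: "integrable ?M (indicator A :: _ \<Rightarrow> real)" for A
    by (rule measure_pmf.integrable_const_bound[where B = 1]) auto
  have "measure_pmf.expectation (deletion_pmf p) X = (\<Sum>v\<in>verts G. measure_pmf.prob (deletion_pmf p) {f. {v} \<subseteq> deleted f})"
    unfolding X_def using int by (subst Bochner_Integration.integral_sum) auto
  also have "\<dots> = (\<Sum>v\<in>verts G. p)"
    using p by (intro sum.cong refl) (subst prob_all_deleted, auto)
  finally have "measure_pmf.expectation (deletion_pmf p) X = card (verts G) * p" by simp
  moreover have "integrable ?M X" unfolding X_def using int by (intro Bochner_Integration.integrable_sum)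
  moreover have "AE f in ?M. 0 \<le> X f" by (simp add: X)
  ultimately have "measure_pmf.prob (deletion_pmf p) {f \<in> space ?M. a \<le> X f} \<le> card (verts G) * p / a"
    using integral_Markov_inequality_measure[of ?M X UNIV a] a by simp
  then show ?thesis by (simp add: X)
qed

lemma finite_connected_sets: "finite {U. U \<subseteq> verts G \<and> connected_set U \<and> card U = u}"
  by (rule finite_subset[of _ "Pow (verts G)"]) auto

text \<open>
  The union bound runs over the connected sets \<open>U\<close> of each size \<open>u\<close> and over the subsets of their
  neighbourhoods, of which there are at most \<open>2\<^bsup>Bu\<^esup>\<close>.
\<close>
lemma prob_large_set_loses_neighborhood:
  fixes p c :: real and K B :: nat
  assumes p: "0 < p" "p \<le> 1"
    and deg: "\<And>v. v \<in> verts G \<Longrightarrow> out_degree G v \<le> B" and B: "1 \<le> B"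
  shows "measure_pmf.prob (deletion_pmf p)
      {f. \<exists>U. U \<subseteq> verts G \<and> connected_set U \<and> K < card U \<and> c * card U \<le> card (neighborhood G U \<inter> deleted f)}
    \<le> (\<Sum>u\<in>{K<..card (verts G)}. card (verts G) * (B\<^sup>2 * 2 ^ B * p powr c) ^ u)"
proof -
  let ?n = "card (verts G)"
  let ?conn = "\<lambda>u. {U. U \<subseteq> verts G \<and> connected_set U \<and> card U = u}"
  define \<S> where "\<S> u = (\<Union>U\<in>?conn u. {S. S \<subseteq> neighborhood G U \<and> c * u \<le> card S})" for u :: nat
  have fin: "finite (\<S> u)" for u
    unfolding \<S>_def using finite_connected_sets by (intro finite_UN_I) auto
  have card: "card (\<S> u) \<le> ?n * B ^ (2 * u) * 2 ^ (B * u)" for u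
  proof -
    have "card (\<S> u) \<le> (\<Sum>U\<in>?conn u. card {S. S \<subseteq> neighborhood G U \<and> c * u \<le> card S})"
      unfolding \<S>_def using finite_connected_sets by (rule card_UN_le)
    also have "\<dots> \<le> (\<Sum>U\<in>?conn u. 2 ^ (B * u))"
    proof (rule sum_mono)
      fix U assume U: "U \<in> ?conn u"
      have "card {S. S \<subseteq> neighborhood G U \<and> c * u \<le> card S} \<le> card (Pow (neighborhood G U))"
        by (intro card_mono) auto
      also have "\<dots> = 2 ^ card (neighborhood G U)" by (simp add: card_Pow)
      also have "\<dots> \<le> 2 ^ (B * u)" using card_neighborhood_le[OF deg, of U] U by (intro power_increasing) auto
      finally show "card {S. S \<subseteq> neighborhood G U \<and> c * u \<le> card S} \<le> 2 ^ (B * u)" .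
    qed
    also have "\<dots> \<le> ?n * B ^ (2 * u) * 2 ^ (B * u)" using card_connected_sets_le[OF deg B] by simp
    finally show ?thesis .
  qed
  let ?bad = "{f. \<exists>U. U \<subseteq> verts G \<and> connected_set U \<and> K < card U \<and> c * card U \<le> card (neighborhood G U \<inter> deleted f)}"
  have "?bad \<subseteq> (\<Union>u\<in>{K<..?n}. {f. \<exists>S\<in>\<S> u. S \<subseteq> deleted f})"
  proof
    fix f assume "f \<in> ?bad"
    then obtain U where U: "U \<subseteq> verts G" "connected_set U" "K < card U"
      "c * card U \<le> card (neighborhood G U \<inter> deleted f)" by blast
    then have "neighborhood G U \<inter> deleted f \<in> \<S> (card U)" unfolding \<S>_def by blast
    moreover have "card U \<in> {K<..?n}" using U card_mono[OF finite_verts U(1)] by simp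
    ultimately show "f \<in> (\<Union>u\<in>{K<..?n}. {f. \<exists>S\<in>\<S> u. S \<subseteq> deleted f})" by blast
  qed
  then have "measure_pmf.prob (deletion_pmf p) ?bad \<le>
      measure_pmf.prob (deletion_pmf p) (\<Union>u\<in>{K<..?n}. {f. \<exists>S\<in>\<S> u. S \<subseteq> deleted f})"
    by (intro measure_pmf.finite_measure_mono) auto
  also have "\<dots> \<le> (\<Sum>u\<in>{K<..?n}. measure_pmf.prob (deletion_pmf p) {f. \<exists>S\<in>\<S> u. S \<subseteq> deleted f})"
    by (rule measure_UNION_le) auto
  also have "\<dots> \<le> (\<Sum>u\<in>{K<..?n}. ?n * (B\<^sup>2 * 2 ^ B * p powr c) ^ u)"
  proof (rule sum_mono)
    fix u
    have "measure_pmf.prob (deletion_pmf p) {f. \<exists>S\<in>\<S> u. S \<subseteq> deleted f} \<le> card (\<S> u) * p powr (c * u)"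
      using neighborhood_subset by (intro prob_some_deleted p fin) (auto simp: \<S>_def)
    also have "\<dots> \<le> real (?n * B ^ (2 * u) * 2 ^ (B * u)) * p powr (c * u)"
      using card by (intro mult_right_mono) (simp_all only: of_nat_le_iff powr_ge_zero)
    also have "p powr (c * u) = (p powr c) ^ u" using p by (simp add: powr_powr[symmetric] powr_realpow)
    also have "real (?n * B ^ (2 * u) * 2 ^ (B * u)) * (p powr c) ^ u = ?n * (B\<^sup>2 * 2 ^ B * p powr c) ^ u"
      by (simp add: power_mult power_mult_distrib)
    finally show "measure_pmf.prob (deletion_pmf p) {f. \<exists>S\<in>\<S> u. S \<subseteq> deleted f} \<le> ?n * (B\<^sup>2 * 2 ^ B * p powr c) ^ u" .
  qed
  finally show ?thesis .
qed

lemma prob_small_set_loses_neighborhood: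
  fixes p t :: real and K B :: nat
  assumes p: "0 < p" "p \<le> 1"
    and deg: "\<And>v. v \<in> verts G \<Longrightarrow> out_degree G v \<le> B" and B: "1 \<le> B"
  shows "measure_pmf.prob (deletion_pmf p)
      {f. \<exists>U. U \<subseteq> verts G \<and> connected_set U \<and> card U \<le> K \<and> t \<le> card (neighborhood G U) \<and> neighborhood G U \<subseteq> deleted f}
    \<le> (K + 1) * card (verts G) * B ^ (2 * K) * p powr t"
proof -
  let ?n = "card (verts G)"
  let ?conn = "\<lambda>u. {U. U \<subseteq> verts G \<and> connected_set U \<and> card U = u}"
  define \<S> where "\<S> = neighborhood G ` {U \<in> (\<Union>u\<in>{..K}. ?conn u). t \<le> card (neighborhood G U)}"
  have fin: "finite (\<Union>u\<in>{..K}. ?conn u)" using finite_connected_sets by blast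
  have fin': "finite {U \<in> (\<Union>u\<in>{..K}. ?conn u). t \<le> card (neighborhood G U)}"
    by (rule finite_subset[OF _ fin]) blast
  have "card \<S> \<le> card {U \<in> (\<Union>u\<in>{..K}. ?conn u). t \<le> card (neighborhood G U)}"
    unfolding \<S>_def by (rule card_image_le[OF fin'])
  also have "\<dots> \<le> card (\<Union>u\<in>{..K}. ?conn u)" by (rule card_mono[OF fin]) blast
  also have "\<dots> \<le> (\<Sum>u\<in>{..K}. card (?conn u))" by (rule card_UN_le) simp
  also have "\<dots> \<le> (\<Sum>u\<in>{..K}. ?n * B ^ (2 * K))"
  proof (rule sum_mono)
    fix u assume "u \<in> {..K}"
    then have "?n * B ^ (2 * u) \<le> ?n * B ^ (2 * K)" using B by (intro mult_left_mono power_increasing) auto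
    then show "card (?conn u) \<le> ?n * B ^ (2 * K)" using card_connected_sets_le[OF deg B, of u] by linarith
  qed
  finally have card: "card \<S> \<le> (K + 1) * ?n * B ^ (2 * K)" by (simp add: algebra_simps)
  have "{f. \<exists>U. U \<subseteq> verts G \<and> connected_set U \<and> card U \<le> K \<and> t \<le> card (neighborhood G U) \<and> neighborhood G U \<subseteq> deleted f}
      = {f. \<exists>S\<in>\<S>. S \<subseteq> deleted f}" unfolding \<S>_def by auto
  also have "measure_pmf.prob (deletion_pmf p) \<dots> \<le> card \<S> * p powr t"
    using fin' neighborhood_subset by (intro prob_some_deleted p) (auto simp: \<S>_def)
  also have "\<dots> \<le> real ((K + 1) * ?n * B ^ (2 * K)) * p powr t"
    using card by (intro mult_right_mono) (simp_all only: of_nat_le_iff powr_ge_zero)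
  finally show ?thesis by simp
qed

end

section \<open>Random deletion in graphs with a spectral gap\<close>

text \<open>
  The three summands of the error bound the probabilities that too many vertices are deleted, that a
  connected set with more than \<open>K\<close> vertices loses half of its guaranteed neighbours, and that a
  smaller one with at least \<open>t\<close> neighbours loses all of them. With \<open>p = n\<^bsup>- \<alpha>\<^esup>\<close>, the last one is of
  order \<open>n p\<^bsup>t\<^esup> = n\<^bsup>- \<alpha> / (2 B\<^sup>4)\<^esup>\<close>. The choice \<open>K \<ge> 12 / (\<alpha> c)\<close> makes each term of the middle one at
  most \<open>n\<^bsup>-2\<^esup>\<close>.
\<close>
lemma (in contracting_graph) prob_deletion_leaves_expander_ge:
  fixes \<alpha> \<epsilon> :: real and B K :: nat
  defines "n \<equiv> real (card (verts G))" and "c \<equiv> \<epsilon>\<^sup>2 / (2 * real B ^ 2)" and "t \<equiv> 1 / \<alpha> + 1 / (2 * real B ^ 4)"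
  assumes \<alpha>: "\<alpha> > 0" and \<epsilon>: "\<epsilon> > 0" and B: "B \<ge> 1" and K: "K \<ge> 1" "12 \<le> \<alpha> * c * K"
    and deg: "\<And>v. v \<in> verts G \<Longrightarrow> out_degree G v \<le> B" and dB: "d \<le> B" and gap: "\<epsilon> < d - \<theta>"
    and n: "1 \<le> n" "2 * real B ^ 4 * (real K)\<^sup>2 \<le> n" "2 * (real B + 1) * K \<le> n"
      "2 * n powr (1 - \<alpha> / 2) < n" "4 * n powr (1 - \<alpha> / 2) \<le> c * n" "(real B)\<^sup>2 * 2 ^ B \<le> n powr (\<alpha> * c / 4)"
  shows "1 - (n powr (- \<alpha> / 2) + 1 / n + (K + 1) * real B ^ (2 * K) * n powr (- \<alpha> / (2 * real B ^ 4)))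
    \<le> measure_pmf.prob (deletion_pmf (n powr (- \<alpha>)))
      {f. \<exists>C\<in>components (G \<restriction> (verts G - deleted f)).
        n - (1 + 1 / c) * n powr (1 - \<alpha> / 2) \<le> card (verts C) \<and> expander (min (1 / K) (c / 2) / B) C \<and>
        (\<forall>C'\<in>components (G \<restriction> (verts G - deleted f)). C' \<noteq> C \<longrightarrow>
           card (verts C') \<le> \<theta>\<^sup>2 / ((d\<^sup>2 - \<theta>\<^sup>2) * \<alpha>))}" (is "_ \<le> measure_pmf.prob ?P ?good")
proof -
  let ?m = "n powr (1 - \<alpha> / 2)" and ?p = "n powr (- \<alpha>)"
  have d: "d > \<epsilon>" using gap theta_nonneg by linarith
  have c: "c > 0" using \<epsilon> B by (simp add: c_def)
  have B4: "real B ^ 4 > 0" using B by simp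
  have p: "0 < ?p" "?p \<le> 1" using n(1) \<alpha> powr_mono[of "- \<alpha>" 0 n] by auto
  have sq: "\<epsilon>\<^sup>2 \<le> d\<^sup>2 - \<theta>\<^sup>2"
  proof -
    have "\<epsilon> * \<epsilon> \<le> (d - \<theta>) * (d + \<theta>)" using \<epsilon> gap theta_nonneg d by (intro mult_mono) auto
    then show ?thesis by (simp add: power2_eq_square algebra_simps)
  qed
  have expand: "c * card U \<le> card (neighborhood G U)"
    if U: "U \<subseteq> verts G" "2 * card U \<le> card (verts G)" for U
  proof (cases "U = {}")
    case False
    have "c \<le> (d\<^sup>2 - \<theta>\<^sup>2) / (2 * d\<^sup>2)"
      unfolding c_def using sq d \<epsilon> dB B less_imp_le[OF theta_sq_less] by (intro frac_le mult_left_mono power_mono) auto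
    then have "c * card U \<le> (d\<^sup>2 - \<theta>\<^sup>2) / (2 * d\<^sup>2) * card U" by (intro mult_right_mono) auto
    also have "\<dots> \<le> card (neighborhood G U)"
      using U False by (intro card_neighborhood_ge) auto
    finally show ?thesis .
  qed simp
  have small_large_nbhd: "t \<le> card (neighborhood G U)"
    if U: "U \<subseteq> verts G" "connected_set U" "card U \<le> K" and big: "\<theta>\<^sup>2 / ((d\<^sup>2 - \<theta>\<^sup>2) * \<alpha>) < card U" for U
  proof -
    let ?W = "U \<union> neighborhood G U"
    have U_ne: "U \<noteq> {}" using U(2) by (simp add: connected_set_def)
    have W: "?W \<subseteq> verts G" using U(1) neighborhood_subset by blast
    have "card ?W \<le> card U + card (neighborhood G U)" by (rule card_Un_le)
    also have "\<dots> \<le> K + B * K"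
      using card_neighborhood_le[OF deg U(1)] U(3) mult_le_mono2[OF U(3), of B] by linarith
    finally have "2 * card ?W \<le> 2 * (K + B * K)" by simp
    then have "real (2 * card ?W) \<le> real (2 * (K + B * K))" by (simp only: of_nat_le_iff)
    also have "\<dots> = 2 * (real B + 1) * K" by (simp add: algebra_simps)
    also have "\<dots> \<le> real (card (verts G))" using n(3) by (simp only: n_def)
    finally have "2 * card ?W \<le> card (verts G)" by (simp only: of_nat_le_iff)
    then have "c * card ?W \<le> card (neighborhood G ?W)" by (rule expand[OF W])
    moreover have "card ?W > 0" using U_ne finite_subset[OF W] by (simp add: card_gt_0_iff)
    then have "c * card ?W > 0" using c by simp
    \<comment> \<open>The set \<open>?W\<close> covers at most half of the graph, so expansion provides vertices at distance two from \<open>U\<close>.\<close>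
    ultimately have far: "neighborhood G ?W \<noteq> {}" by auto
    have *: "\<theta> > 0" "(d\<^sup>2 - \<theta>\<^sup>2) / \<theta>\<^sup>2 * card U + 1 / (2 * real B ^ 4) \<le> card (neighborhood G U)"
      using card_neighborhood_ge_strict[OF U(1) U_ne far dB _ n(2)[unfolded n_def]] U(3) by auto
    have "1 / \<alpha> = (d\<^sup>2 - \<theta>\<^sup>2) / \<theta>\<^sup>2 * (\<theta>\<^sup>2 / ((d\<^sup>2 - \<theta>\<^sup>2) * \<alpha>))"
      using *(1) theta_sq_less by simp
    also have "\<dots> \<le> (d\<^sup>2 - \<theta>\<^sup>2) / \<theta>\<^sup>2 * card U"
      using big theta_sq_less by (intro mult_left_mono) auto
    finally show ?thesis unfolding t_def using *(2) by linarith
  qed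
  \<comment> \<open>The threshold \<open>?m\<close> exceeds the expected number of deleted vertices by the factor \<open>n\<^bsup>\<alpha>/2\<^esup>\<close>.\<close>
  define bad\<^sub>1 where "bad\<^sub>1 = {f. ?m \<le> card (deleted f)}"
  define bad\<^sub>2 where "bad\<^sub>2 = {f. \<exists>U. U \<subseteq> verts G \<and> connected_set U \<and> K < card U \<and> c / 2 * card U \<le> card (neighborhood G U \<inter> deleted f)}"
  define bad\<^sub>3 where "bad\<^sub>3 = {f. \<exists>U. U \<subseteq> verts G \<and> connected_set U \<and> card U \<le> K \<and> t \<le> card (neighborhood G U) \<and> neighborhood G U \<subseteq> deleted f}"
  have good: "f \<in> ?good" if f: "f \<notin> bad\<^sub>1" "f \<notin> bad\<^sub>2" "f \<notin> bad\<^sub>3" for f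
  proof -
    have few: "card (deleted f) < ?m" using f(1) by (simp add: bad\<^sub>1_def)
    have few': "2 * card (deleted f) < card (verts G)" "4 * card (deleted f) \<le> c * card (verts G)"
    proof -
      have "real (2 * card (deleted f)) < n" using few n(4) by simp
      then show "2 * card (deleted f) < card (verts G)" unfolding n_def by (simp only: of_nat_less_iff)
      show "4 * card (deleted f) \<le> c * card (verts G)" using few n(5) by (simp add: n_def)
    qed
    have large: "card (neighborhood G U \<inter> deleted f) < c / 2 * card U"
      if U: "U \<subseteq> verts G" "connected_set U" "K < card U" for U
    proof (rule ccontr)
      assume "\<not> card (neighborhood G U \<inter> deleted f) < c / 2 * card U"
      then have "c / 2 * card U \<le> card (neighborhood G U \<inter> deleted f)" by (simp only: not_less)
      with U have "f \<in> bad\<^sub>2" unfolding bad\<^sub>2_def by blast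
      then show False using f(2) by blast
    qed
    have small: "card U \<le> \<theta>\<^sup>2 / ((d\<^sup>2 - \<theta>\<^sup>2) * \<alpha>)"
      if U: "U \<subseteq> verts G" "connected_set U" "card U \<le> K" "neighborhood G U \<subseteq> deleted f" for U
    proof (rule ccontr)
      assume "\<not> card U \<le> \<theta>\<^sup>2 / ((d\<^sup>2 - \<theta>\<^sup>2) * \<alpha>)"
      then have "t \<le> card (neighborhood G U)" using small_large_nbhd[OF U(1-3)] by (simp only: not_le)
      with U have "f \<in> bad\<^sub>3" unfolding bad\<^sub>3_def by blast
      then show False using f(3) by blast
    qed
    obtain C where C: "C \<in> components (G \<restriction> (verts G - deleted f))"
      "card (verts G) - (1 + 1 / c) * card (deleted f) \<le> card (verts C)"
      "expander (min (1 / K) (c / 2) / B) C"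
      "\<forall>C'\<in>components (G \<restriction> (verts G - deleted f)). C' \<noteq> C \<longrightarrow> card (verts C') \<le> \<theta>\<^sup>2 / ((d\<^sup>2 - \<theta>\<^sup>2) * \<alpha>)"
      using deletion_leaves_expander[OF deleted_subset c K(1) B expand deg few' large small] by blast
    have "(1 + 1 / c) * card (deleted f) \<le> (1 + 1 / c) * ?m" using few c by (intro mult_left_mono) auto
    then have "n - (1 + 1 / c) * ?m \<le> card (verts C)" using C(2) by (simp add: n_def)
    then show ?thesis using C by blast
  qed
  have bad1: "measure_pmf.prob ?P bad\<^sub>1 \<le> n powr (- \<alpha> / 2)"
  proof -
    have "measure_pmf.prob ?P bad\<^sub>1 \<le> n * ?p / ?m"
      unfolding bad\<^sub>1_def n_def[symmetric] using prob_many_deleted[of ?p ?m] p n(1) by (simp add: n_def)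
    also have "\<dots> = n powr (1 + - \<alpha> - (1 - \<alpha> / 2))"
      using n(1) by (simp only: powr_add powr_diff powr_one)
    also have "1 + - \<alpha> - (1 - \<alpha> / 2) = - \<alpha> / 2" by (simp add: field_simps)
    finally show ?thesis .
  qed
  have bad2: "measure_pmf.prob ?P bad\<^sub>2 \<le> 1 / n"
  proof -
    \<comment> \<open>Since \<open>p = n\<^bsup>- \<alpha>\<^esup>\<close>, half of the exponent \<open>\<alpha> c / 2\<close> absorbs the number of sets per vertex.\<close>
    define q where "q = (real B)\<^sup>2 * 2 ^ B * ?p powr (c / 2)"
    have q0: "q \<ge> 0" by (simp add: q_def)
    have "q \<le> n powr (\<alpha> * c / 4) * ?p powr (c / 2)" unfolding q_def using n(6) by (intro mult_right_mono) auto
    also have "\<dots> = n powr (\<alpha> * c / 4 + - \<alpha> * (c / 2))" by (simp only: powr_powr powr_add)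
    also have "\<alpha> * c / 4 + - \<alpha> * (c / 2) = - (\<alpha> * c / 4)" by (simp add: field_simps)
    finally have q: "q \<le> n powr (- (\<alpha> * c / 4))" .
    have summand: "n * q ^ u \<le> 1 / n\<^sup>2" if u: "u \<in> {K<..card (verts G)}" for u
    proof -
      have "q ^ u \<le> (n powr (- (\<alpha> * c / 4))) ^ u" using q q0 by (intro power_mono)
      also have "\<dots> = (n powr (- (\<alpha> * c / 4))) powr u" using n(1) by (intro powr_realpow[symmetric]) simp
      also have "\<dots> = n powr (- (\<alpha> * c / 4) * u)" by (rule powr_powr)
      also have "\<dots> \<le> n powr (- 3)"
      proof (rule powr_mono)
        have "\<alpha> * c * K \<le> \<alpha> * c * u" using u \<alpha> c by (intro mult_left_mono) auto
        then show "- (\<alpha> * c / 4) * u \<le> - 3" using K(2) by simp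
      qed (use n in simp)
      finally have "n * q ^ u \<le> n * n powr (- 3)" using n(1) by (intro mult_left_mono) auto
      also have "n * n powr (- 3) = n powr (1 + - 3)" using n(1) by (simp only: powr_add powr_one)
      also have "\<dots> = 1 / n\<^sup>2" using n(1) by (simp add: powr_minus_divide powr_numeral)
      finally show ?thesis .
    qed
    have "measure_pmf.prob ?P bad\<^sub>2 \<le> (\<Sum>u\<in>{K<..card (verts G)}. n * q ^ u)"
      unfolding bad\<^sub>2_def n_def q_def using prob_large_set_loses_neighborhood[OF p deg B, of K "c / 2"] by (simp add: n_def)
    also have "\<dots> \<le> (\<Sum>u\<in>{K<..card (verts G)}. 1 / n\<^sup>2)" using summand by (rule sum_mono)
    also have "\<dots> \<le> n * (1 / n\<^sup>2)" by (simp add: n_def divide_right_mono)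
    also have "\<dots> = 1 / n" using n(1) by (simp add: power2_eq_square)
    finally show ?thesis .
  qed
  have bad3: "measure_pmf.prob ?P bad\<^sub>3 \<le> (K + 1) * real B ^ (2 * K) * n powr (- \<alpha> / (2 * real B ^ 4))"
  proof -
    have "measure_pmf.prob ?P bad\<^sub>3 \<le> (K + 1) * n * real B ^ (2 * K) * ?p powr t"
      unfolding bad\<^sub>3_def n_def using prob_small_set_loses_neighborhood[OF p deg B, of K t] by (simp add: n_def algebra_simps)
    also have "\<dots> = (K + 1) * real B ^ (2 * K) * (n * ?p powr t)" by (simp add: algebra_simps)
    also have "n * ?p powr t = n powr (1 + - \<alpha> * t)" using n(1) by (simp only: powr_add powr_one powr_powr)
    also have "1 + - \<alpha> * t = - \<alpha> / (2 * real B ^ 4)" using \<alpha> B4 by (simp add: t_def field_simps)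
    finally show ?thesis .
  qed
  have "1 - measure_pmf.prob ?P (bad\<^sub>1 \<union> bad\<^sub>2 \<union> bad\<^sub>3) = measure_pmf.prob ?P (- (bad\<^sub>1 \<union> bad\<^sub>2 \<union> bad\<^sub>3))"
    by (subst measure_pmf.prob_compl[symmetric]) (auto simp: Compl_eq_Diff_UNIV)
  also have "\<dots> \<le> measure_pmf.prob ?P ?good"
    using good by (intro measure_pmf.finite_measure_mono) auto
  finally have "1 - measure_pmf.prob ?P (bad\<^sub>1 \<union> bad\<^sub>2 \<union> bad\<^sub>3) \<le> measure_pmf.prob ?P ?good" .
  moreover have "measure_pmf.prob ?P (bad\<^sub>1 \<union> bad\<^sub>2 \<union> bad\<^sub>3) \<le>
      measure_pmf.prob ?P bad\<^sub>1 + measure_pmf.prob ?P bad\<^sub>2 + measure_pmf.prob ?P bad\<^sub>3"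
    using measure_Un_le[of "bad\<^sub>1 \<union> bad\<^sub>2" "measure_pmf ?P" "bad\<^sub>3"] measure_Un_le[of bad\<^sub>1 "measure_pmf ?P" bad\<^sub>2] by simp
  ultimately show ?thesis using bad1 bad2 bad3 by linarith
qed

theorem theorem3p2:
  fixes \<alpha> \<epsilon> :: real and \<Delta> :: nat
  assumes "\<alpha> > 0" and "\<epsilon> > 0"
  shows "\<exists>\<beta>>0. \<forall>(I :: nat set) (G :: nat \<Rightarrow> nat pair_pre_digraph).
    infinite I \<longrightarrow>
    (\<forall>n\<in>I. pair_graph (G n) \<and> card (verts (G n)) = n \<and> max_degree (G n) = \<Delta> \<and>
            avg_degree (G n) - theta (G n) > \<epsilon>) \<longrightarrow>
    (\<exists>r :: nat \<Rightarrow> real. r \<in> o(\<lambda>n. real n) \<and>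
      ((\<lambda>n. measure_pmf.prob (random_deletion (G n) (real n powr (- \<alpha>)))
          {H. \<exists>C\<in>components H.
                real (card (verts C)) \<ge> real n - r n \<and> expander \<beta> C \<and>
                (\<forall>C'\<in>components H. C' \<noteq> C \<longrightarrow>
                  real (card (verts C')) \<le>
                    (theta (G n))\<^sup>2 / (((avg_degree (G n))\<^sup>2 - (theta (G n))\<^sup>2) * \<alpha>))})
        \<longlongrightarrow> 1) (inf sequentially (principal I)))"
proof -
  \<comment> \<open>The successor keeps \<open>B\<close> positive, so that \<open>c\<close> and \<open>\<beta>\<close> are positive for every \<open>\<Delta>\<close>.\<close>
  define B where "B = \<Delta> + 1"
  define c where "c = \<epsilon>\<^sup>2 / (2 * real B ^ 2)"
  define K where "K = nat \<lceil>12 / (\<alpha> * c)\<rceil> + 1"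
  define \<beta> where "\<beta> = min (1 / real K) (c / 2) / B"
  define r where "r n = (1 + 1 / c) * real n powr (1 - \<alpha> / 2)" for n :: nat
  define err where "err n = real n powr (- \<alpha> / 2) + 1 / real n
    + (K + 1) * real B ^ (2 * K) * real n powr (- \<alpha> / (2 * real B ^ 4))" for n :: nat
  have B: "B \<ge> 1" by (simp add: B_def)
  have c: "c > 0" using assms B by (simp add: c_def)
  have ac: "\<alpha> * c > 0" using assms c by simp
  have K: "K \<ge> 1" by (simp add: K_def)
  have K12: "12 \<le> \<alpha> * c * K"
  proof -
    have "12 / (\<alpha> * c) \<le> real K" unfolding K_def by linarith
    then show ?thesis using ac by (simp add: field_simps)
  qed
  have "\<beta> > 0" using K c B by (simp add: \<beta>_def)
  show ?thesis
  proof (intro exI[of _ \<beta>] exI[of _ r] conjI allI impI)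
    fix I :: "nat set" and G :: "nat \<Rightarrow> nat pair_pre_digraph"
    assume G: "\<forall>n\<in>I. pair_graph (G n) \<and> card (verts (G n)) = n \<and> max_degree (G n) = \<Delta> \<and>
            avg_degree (G n) - theta (G n) > \<epsilon>"
    show "r \<in> o(\<lambda>n. real n)"
      unfolding r_def using assms(1) c by real_asymp
    let ?F = "inf sequentially (principal I)"
    let ?prob = "\<lambda>n. measure_pmf.prob (random_deletion (G n) (real n powr (- \<alpha>)))
          {H. \<exists>C\<in>components H.
                real (card (verts C)) \<ge> real n - r n \<and> expander \<beta> C \<and>
                (\<forall>C'\<in>components H. C' \<noteq> C \<longrightarrow>
                  real (card (verts C')) \<le>
                    (theta (G n))\<^sup>2 / (((avg_degree (G n))\<^sup>2 - (theta (G n))\<^sup>2) * \<alpha>))}"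
    have "\<forall>\<^sub>F n in sequentially. 2 \<le> n \<and> 2 * real B ^ 4 * (real K)\<^sup>2 \<le> n \<and> 2 * (real B + 1) * K \<le> n \<and>
        2 * real n powr (1 - \<alpha> / 2) < n \<and> 4 * real n powr (1 - \<alpha> / 2) \<le> c * n \<and> (real B)\<^sup>2 * 2 ^ B \<le> real n powr (\<alpha> * c / 4)"
      using assms(1) c ac by (intro eventually_conj) real_asymp+
    then have lower: "\<forall>\<^sub>F n in ?F. 1 - err n \<le> ?prob n"
      unfolding eventually_inf_principal
    proof eventually_elim
      case (elim n)
      show ?case
      proof
        assume "n \<in> I"
        then have "pair_graph (G n)" and card: "card (verts (G n)) = n" and max: "max_degree (G n) = \<Delta>"
          and gap: "\<epsilon> < avg_degree (G n) - theta (G n)" using G by auto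
        then have graph: "graph (G n)" by (intro pair_graph.pair_graphD_graph)
        interpret contracting_graph "G n" "avg_degree (G n)" "theta (G n)"
          using elim card gap assms(2) by (intro contracting_graphI graph) auto
        have deg: "out_degree (G n) v \<le> B" if "v \<in> verts (G n)" for v
        proof -
          have "out_degree (G n) v \<le> max_degree (G n)"
            unfolding max_degree_def by (intro Max_ge finite_imageI imageI finite_verts that)
          then show ?thesis using max by (simp add: B_def)
        qed
        have avg: "avg_degree (G n) \<le> B"
          by (intro avg_degree_le finite_verts deg) (use elim card in auto)
        have "1 - err n \<le> measure_pmf.prob (deletion_pmf (real n powr (- \<alpha>)))
          {f. \<exists>C\<in>components (G n \<restriction> (verts (G n) - deleted f)).
            real n - r n \<le> real (card (verts C)) \<and> expander \<beta> C \<and>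
            (\<forall>C'\<in>components (G n \<restriction> (verts (G n) - deleted f)). C' \<noteq> C \<longrightarrow>
               real (card (verts C')) \<le>
                 (theta (G n))\<^sup>2 / (((avg_degree (G n))\<^sup>2 - (theta (G n))\<^sup>2) * \<alpha>))}"
          unfolding err_def r_def \<beta>_def c_def
          by (rule prob_deletion_leaves_expander_ge[of \<alpha> \<epsilon> B K, unfolded card,
                OF assms B K K12[unfolded c_def] deg avg gap])
            (use elim in \<open>simp_all only: c_def, simp_all\<close>)
        also have "\<dots> = ?prob n"
        proof -
          have "{v \<in> verts (G n). \<not> f v} = verts (G n) - deleted f" for f
            by (auto simp: deleted_def)
          then show ?thesis by (simp add: random_deletion_def deletion_pmf_def)
        qed
        finally show "1 - err n \<le> ?prob n" .
      qed
    qed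
    have err_0: "((\<lambda>n. 1 - err n) \<longlongrightarrow> 1) ?F"
    proof (rule tendsto_mono[OF inf_le1])
      have powr_0: "(\<lambda>n. real n powr (- x / y)) \<longlonglongrightarrow> 0" if "x > 0" "y > 0" for x y :: real
      proof -
        have "x / y > 0" using that by simp
        then have "(\<lambda>n. real n powr (- (x / y))) \<longlonglongrightarrow> 0" by real_asymp
        then show ?thesis by simp
      qed
      have "err \<longlonglongrightarrow> 0 + 0 + (K + 1) * real B ^ (2 * K) * 0"
        unfolding err_def[abs_def] using assms(1) B
        by (intro tendsto_add tendsto_mult tendsto_const powr_0 lim_1_over_n) auto
      then have "err \<longlonglongrightarrow> 0" by simp
      then show "(\<lambda>n. 1 - err n) \<longlonglongrightarrow> 1" using tendsto_diff[OF tendsto_const, of err 0 sequentially 1] by simp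
    qed
    show "(?prob \<longlongrightarrow> 1) ?F"
      by (rule tendsto_sandwich[OF lower _ err_0 tendsto_const]) simp
  qed (fact \<open>\<beta> > 0\<close>)
qed

end
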